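(* Let $(M,d,m)$ be a metric measure space satisfying the reduced curvature-dimension condition $\mathsf{CD}^*(K,N)$ for two real parameters $K>0$ and $N\ge 1$. Then for every Lipschitz function $f:M\to\mathbb{R}$ with $\int_Mf\,dm=0$, $$\int_Mf^2\,dm\le\frac1K\int_M|\nabla^-f|^2\,dm.$$
   Context: A metric measure space $(M,d,m)$ consists of a complete separable metric space $(M,d)$ and a locally finite Borel measure $m$ (for every $x\in M$, $m(B_r(x))<\infty$ for all sufficiently small $r>0$). No non-branching assumption is made. For a Lipschitz function $f$ on $M$, $|\nabla^-f|(x):=\limsup_{y\to x}\frac{[f(y)-f(x)]_-}{d(x,y)}$, where $a_-:=\max(-a,0)$ (and $|\nabla^- f|(x)=0$ at isolated points). $\mathcal{P}_2(M,d)$ is the space of Borel probability measures with finite second moment, with the $L_2$-Wasserstein distance $d_W(\mu,\nu)=\inf_q\big(\int d^2\,dq\big)^{1/2}$ over couplings $q$ of $\mu,\nu$; optimal couplings are the minimizers. $\mathcal{P}_\infty(M,d,m)$ is the subspace of $m$-absolutely continuous probability measures with bounded support. A geodesic $\Gamma:[0,1]\to\mathcal{P}_\infty(M,d,m)$ is a curve with $d_W(\Gamma(s),\Gamma(t))=|s-t|\,d_W(\Gamma(0),\Gamma(1))$. For $\nu=\rho m$ and $N'\ge 1$, $S_{N'}(\nu|m):=-\int_M\rho^{1-1/N'}\,dm$ (with $0^0=0$ when $N'=1$). For $K>0$, $\theta\ge 0$, $t\in[0,1]$: $\sigma^{(t)}_{K,N}(\theta)=\infty$ if $K\theta^2\ge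 N\pi^2$, and $\sigma^{(t)}_{K,N}(\theta)=\frac{\sin(t\theta\sqrt{K/N})}{\sin(\theta\sqrt{K/N})}$ otherwise (value $t$ at $\theta=0$). $\mathsf{CD}^*(K,N)$: for all $\nu_0=\rho_0m,\nu_1=\rho_1m\in\mathcal{P}_\infty(M,d,m)$ there exist an optimal coupling $q$ of $\nu_0,\nu_1$ and a geodesic $\Gamma:[0,1]\to\mathcal{P}_\infty(M,d,m)$ connecting them such that for all $t\in[0,1]$ and all $N'\ge N$, $$S_{N'}(\Gamma(t)|m)\le-\int_{M\times M}\Big[\sigma^{(1-t)}_{K,N'}(d(x_0,x_1))\rho_0^{-1/N'}(x_0)+\sigma^{(t)}_{K,N'}(d(x_0,x_1))\rho_1^{-1/N'}(x_1)\Big]dq(x_0,x_1).$$ *)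

theory Defs
  imports "HOL-Probability.Probability"
begin

text \<open>
  The underlying space \<open>(M, d)\<close> is a type of class \<open>polish_space\<close>, i.e. a complete metric space
  (with metric \<open>dist\<close>) whose topology is second countable, equivalently separable.
\<close>

definition metric_measure_space :: "'a::polish_space measure \<Rightarrow> bool" where
  "metric_measure_space m \<longleftrightarrow>
     sets m = sets borel \<and> (\<forall>x. \<exists>r>0. emeasure m (ball x r) < \<infinity>)"

text \<open>
  Since the supremum of the empty set is \<open>0\<close> in \<open>ennreal\<close> and \<open>at x\<close> is the trivial filter at an
  isolated point, the descending slope vanishes at isolated points.
\<close>

definition desc_slope :: "('a::metric_space \<Rightarrow> real) \<Rightarrow> 'a \<Rightarrow> ennreal" where
  "desc_slope f x = Limsup (at x) (\<lambda>y. ennreal (max (- (f y - f x)) 0 / dist x y))"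

lemma desc_slope_isolated: "\<not> x islimpt UNIV \<Longrightarrow> desc_slope f x = 0"
  by (simp add: desc_slope_def trivial_limit_within[symmetric] bot_ennreal[symmetric] Limsup_bot)

definition P2 :: "'a::polish_space measure set" where
  "P2 = {\<mu>. prob_space \<mu> \<and> sets \<mu> = sets borel \<and>
             (\<exists>x0. (\<integral>\<^sup>+x. ennreal ((dist x0 x)\<^sup>2) \<partial>\<mu>) < \<infinity>)}"

definition couplings ::
  "'a::polish_space measure \<Rightarrow> 'a measure \<Rightarrow> ('a \<times> 'a) measure set" where
  "couplings \<mu> \<nu> =
     {q. prob_space q \<and> sets q = sets (borel \<Otimes>\<^sub>M borel) \<and>
         distr q borel fst = \<mu> \<and> distr q borel snd = \<nu>}"

text \<open>
  On \<open>P2\<close> the function \<open>d\<^sup>2\<close> is integrable with respect to every coupling, and the set of couplings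
  is nonempty, so that the real-valued integral and infimum below are the genuine ones.
\<close>

definition transport_cost :: "('a::polish_space \<times> 'a) measure \<Rightarrow> real" where
  "transport_cost q = (\<integral>z. (dist (fst z) (snd z))\<^sup>2 \<partial>q)"

definition wasserstein :: "'a::polish_space measure \<Rightarrow> 'a measure \<Rightarrow> real" where
  "wasserstein \<mu> \<nu> = (INF q\<in>couplings \<mu> \<nu>. sqrt (transport_cost q))"

definition optimal_couplings ::
  "'a::polish_space measure \<Rightarrow> 'a measure \<Rightarrow> ('a \<times> 'a) measure set" where
  "optimal_couplings \<mu> \<nu> =
     {q \<in> couplings \<mu> \<nu>. \<forall>q'\<in>couplings \<mu> \<nu>. transport_cost q \<le> transport_cost q'}"

definition measure_support :: "'a::metric_space measure \<Rightarrow> 'a set" where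
  "measure_support \<mu> = {x. \<forall>r>0. emeasure \<mu> (ball x r) > 0}"

definition Pinf :: "'a::polish_space measure \<Rightarrow> 'a measure set" where
  "Pinf m = {\<nu> \<in> P2. absolutely_continuous m \<nu> \<and> bounded (measure_support \<nu>)}"

definition geodesic_in_Pinf :: "'a::polish_space measure \<Rightarrow> (real \<Rightarrow> 'a measure) \<Rightarrow> bool" where
  "geodesic_in_Pinf m \<Gamma> \<longleftrightarrow>
     (\<forall>t\<in>{0..1}. \<Gamma> t \<in> Pinf m) \<and>
     (\<forall>s\<in>{0..1}. \<forall>t\<in>{0..1}. wasserstein (\<Gamma> s) (\<Gamma> t) = \<bar>s - t\<bar> * wasserstein (\<Gamma> 0) (\<Gamma> 1))"

text \<open>
  The density \<open>\<rho>\<close> of an absolutely continuous \<open>\<nu> = \<rho> m\<close> as a real function; it is determined, and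
  \<open>RN_deriv\<close> is finite, only \<open>m\<close>-almost everywhere.
\<close>

definition dens :: "'a measure \<Rightarrow> 'a measure \<Rightarrow> 'a \<Rightarrow> real" where
  "dens m \<nu> x = enn2real (RN_deriv m \<nu> x)"

text \<open>
  The value may be \<open>-\<infinity>\<close>, as \<open>m\<close> need not be finite on bounded sets. For \<open>N' = 1\<close> the
  convention \<open>0\<^sup>0 = 0\<close> is the library's \<open>0 powr 0 = 0\<close>.
\<close>

definition renyi_entropy :: "real \<Rightarrow> 'a measure \<Rightarrow> 'a measure \<Rightarrow> ereal" where
  "renyi_entropy N' \<nu> m = - enn2ereal (\<integral>\<^sup>+x. ennreal (dens m \<nu> x powr (1 - 1 / N')) \<partial>m)"

definition sigma_coeff :: "real \<Rightarrow> real \<Rightarrow> real \<Rightarrow> real \<Rightarrow> ennreal" where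
  "sigma_coeff K N t \<theta> =
     (if K * \<theta>\<^sup>2 \<ge> N * pi\<^sup>2 then \<infinity>
      else if \<theta> = 0 then ennreal t
      else ennreal (sin (t * \<theta> * sqrt (K / N)) / sin (\<theta> * sqrt (K / N))))"

text \<open>
  Where a density vanishes, its negative power is \<open>0\<close> here instead of \<open>\<infinity>\<close>; for a coupling \<open>q\<close>
  of \<open>\<rho>\<^sub>0 m\<close> and \<open>\<rho>\<^sub>1 m\<close> this happens only on a \<open>q\<close>-null set. All integrands are nonnegative, so
  both sides of the inequality are well-defined elements of \<open>[-\<infinity>, 0]\<close>.
\<close>

definition CD_star :: "real \<Rightarrow> real \<Rightarrow> 'a::polish_space measure \<Rightarrow> bool" where
  "CD_star K N m \<longleftrightarrow>
     (\<forall>\<nu>0\<in>Pinf m. \<forall>\<nu>1\<in>Pinf m.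
        \<exists>q\<in>optimal_couplings \<nu>0 \<nu>1. \<exists>\<Gamma>.
          geodesic_in_Pinf m \<Gamma> \<and> \<Gamma> 0 = \<nu>0 \<and> \<Gamma> 1 = \<nu>1 \<and>
          (\<forall>t\<in>{0..1}. \<forall>N'\<ge>N.
             renyi_entropy N' (\<Gamma> t) m \<le>
             - enn2ereal (\<integral>\<^sup>+(x0, x1).
                  (sigma_coeff K N' (1 - t) (dist x0 x1) * ennreal (dens m \<nu>0 x0 powr (- 1 / N')) +
                   sigma_coeff K N' t (dist x0 x1) * ennreal (dens m \<nu>1 x1 powr (- 1 / N'))) \<partial>q)))"

end

theory Submission
  imports Defs
begin

text \<open>
  Let \<open>h = 1 + e f\<close> and \<open>V = m(M)\<close>. Along the geodesic from \<open>h m / V\<close> to \<open>m / V\<close> the curvature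
  condition with parameter \<open>n\<close>, differentiated at \<open>t = 0\<close>, bounds the entropy gap between the two
  measures plus \<open>K W\<^sup>2 / 2\<close> by \<open>W\<close> times the \<open>L\<^sup>2\<close> norm of the descending slope (up to factors
  close to 1 and the normalisation \<open>1 / n\<close>). Young's inequality removes the Wasserstein distance \<open>W\<close>, and
  the Poincare inequality is the second-order part in \<open>e\<close> as \<open>n\<close> tends to infinity.
  The slope enters through the difference quotients at distances below a scale \<open>r\<close>; larger
  distances contribute only to order \<open>t\<^sup>2\<close>.

  That \<open>m\<close> is finite has to be derived first. The condition at \<open>t = 0\<close> bounds the diameter of the
  support; Brunn-Minkowski from a small ball to an arbitrary set \<open>B\<close> then bounds \<open>m(B)\<close>, once it is
  known that geodesics for the quadratic cost move no point further than \<open>t\<close> times the diameter.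
\<close>

section \<open>Supports and densities\<close>

text \<open>The curvature condition supplies a coupling and a geodesic, but no plan linking the two.
  About the mass at time t only the distances of \<open>\<Gamma> t\<close> to the end points are
  known, so its displacement is measured by a separate optimal coupling of the initial measure and
  \<open>\<Gamma> t\<close>, of cost exactly t^2 W^2. The pointwise displacement bound behind
  finiteness must likewise be extracted from such costs. The density of \<open>\<Gamma> t\<close> is
  uncontrolled too, hence the linearisation of the entropy at the initial density. Starting at the
  perturbed measure puts the slope at the initial point, whose law is comparable to m; a drop of h
  raises \<open>h powr (- 1 / n)\<close>, and this makes the slope a descending one. The 1/2 in
  front of K W^2 is 2/6 + 1/6, the time derivatives at 0 of the quadratic parts of the two
  distortion coefficients. The limits are nested: t to 0 with r fixed, so that large distances drop
  out; n to infinity, which removes a factor 1 - 1/n; e to 0; and r to 0 outermost, where finiteness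
  of m allows dominated convergence.\<close>

lemma AE_in_measure_support:
  fixes m :: "'a::polish_space measure"
  assumes "sets m = sets borel"
  shows "AE x in m. x \<in> measure_support m"
proof -
  obtain B :: "'a set set" where B: "countable B" "topological_basis B"
    using ex_countable_basis by blast
  \<comment> \<open>The null basic open sets are countably many and cover the complement of the
    support.\<close>
  let ?N = "\<Union>{b \<in> B. emeasure m b = 0}"
  have bm: "b \<in> sets m" if "b \<in> B" for b
    using topological_basis_open[OF B(2) that] assms by simp
  have "?N \<in> null_sets m"
    using null_sets_UN'[of "{b \<in> B. emeasure m b = 0}" "\<lambda>b. b" m] B(1) bm
    by (auto simp: null_sets_def)
  moreover have "x \<in> ?N" if nx: "x \<notin> measure_support m" for x
  proof -
    obtain r where r: "r > 0" "emeasure m (ball x r) = 0"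
      using nx by (auto simp: measure_support_def)
    obtain b where b: "b \<in> B" "x \<in> b" "b \<subseteq> ball x r"
      using topological_basisE[OF B(2), of "ball x r" x] r by auto
    have "emeasure m b \<le> emeasure m (ball x r)"
      using b assms by (intro emeasure_mono) auto
    then show ?thesis using b r by auto
  qed
  ultimately show ?thesis
    by (intro AE_I'[of ?N]) auto
qed

text \<open>By the Lindelof property countably many of the balls of finite measure already cover the
  space.\<close>

lemma sigma_finite_metric_measure_space:
  fixes m :: "'a::polish_space measure"
  assumes "metric_measure_space m"
  shows "sigma_finite_measure m"
proof -
  have s: "sets m = sets borel" using assms by (simp add: metric_measure_space_def)
  obtain r where r: "\<And>x. r x > 0" "\<And>x. emeasure m (ball x (r x)) < \<infinity>"
    using assms unfolding metric_measure_space_def by metis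
  let ?F = "range (\<lambda>x. ball x (r x))"
  obtain F' where F': "F' \<subseteq> ?F" "countable F'" "\<Union>F' = \<Union>?F"
    using Lindelof[of ?F] by auto
  have "x \<in> ball x (r x)" for x using r by simp
  then have U: "\<Union>F' = UNIV" using F' by blast
  have sp: "space m = UNIV" using sets_eq_imp_space_eq[OF s] by simp
  show ?thesis
  proof
    show "\<exists>A. countable A \<and> A \<subseteq> sets m \<and> \<Union> A = space m \<and> (\<forall>a\<in>A. emeasure m a \<noteq> \<infinity>)"
    proof (intro exI[of _ F'] conjI)
      show "F' \<subseteq> sets m" using F'(1) s by auto
      show "\<forall>a\<in>F'. emeasure m a \<noteq> \<infinity>" using F'(1) r(2) by (auto simp: less_top)
    qed (use F' U sp in auto)
  qed
qed

lemma dens_density_AE: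
  fixes m :: "'a measure" and h :: "'a \<Rightarrow> real"
  assumes "sigma_finite_measure m" "h \<in> borel_measurable m" "\<And>x. h x \<ge> 0"
  shows "AE x in m. dens m (density m (\<lambda>x. ennreal (h x))) x = h x"
proof -
  have "AE x in m. ennreal (h x) = RN_deriv m (density m (\<lambda>x. ennreal (h x))) x"
    by (rule sigma_finite_measure.RN_deriv_unique[OF assms(1)]) (use assms in auto)
  then show ?thesis
    by eventually_elim (auto simp: dens_def assms dest: sym)
qed

lemma PinfI_AE_bounded:
  fixes m :: "'a::polish_space measure"
  assumes ac: "absolutely_continuous m \<nu>" and p: "prob_space \<nu>" and s: "sets \<nu> = sets borel"
    and R: "AE x in \<nu>. dist x0 x < R"
  shows "\<nu> \<in> Pinf m"
proof -
  interpret prob_space \<nu> by fact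
  have "(\<integral>\<^sup>+x. ennreal ((dist x0 x)\<^sup>2) \<partial>\<nu>) \<le> (\<integral>\<^sup>+x. ennreal (R\<^sup>2) \<partial>\<nu>)"
    by (rule nn_integral_mono_AE) (use R in eventually_elim, auto intro!: ennreal_leI power_mono)
  also have "\<dots> < \<infinity>" by (simp add: emeasure_space_1)
  finally have 1: "\<exists>x0. (\<integral>\<^sup>+x. ennreal ((dist x0 x)\<^sup>2) \<partial>\<nu>) < \<infinity>" by blast
  have "x \<in> cball x0 R" if x: "x \<in> measure_support \<nu>" for x
  proof (rule ccontr)
    assume "x \<notin> cball x0 R"
    then have d: "dist x0 x - R > 0" by auto
    have "emeasure \<nu> (ball x (dist x0 x - R)) = 0"
    proof -
      have "AE y in \<nu>. y \<notin> ball x (dist x0 x - R)"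
        using R
      proof eventually_elim
        case (elim y)
        have "dist x0 x \<le> dist x0 y + dist x y" by (metis dist_commute dist_triangle)
        then show ?case using elim by auto
      qed
      moreover have "ball x (dist x0 x - R) \<in> sets \<nu>" using s by simp
      ultimately show ?thesis
        using AE_iff_measurable[of "ball x (dist x0 x - R)" \<nu> "\<lambda>y. y \<notin> ball x (dist x0 x - R)"]
          sets_eq_imp_space_eq[OF s]
        by (simp add: ball_def)
    qed
    then show False using x d unfolding measure_support_def
      by (metis (mono_tags, lifting) less_irrefl mem_Collect_eq)
  qed
  then have "measure_support \<nu> \<subseteq> cball x0 R" by blast
  then have "bounded (measure_support \<nu>)" using bounded_cball bounded_subset by blast
  with 1 assms show ?thesis by (auto simp: Pinf_def P2_def)
qed

section \<open>Null sets and integrals under the marginals of a coupling\<close>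

lemma AE_coupling_fst:
  "q \<in> couplings \<mu> \<nu> \<Longrightarrow> AE x in \<mu>. P x \<Longrightarrow> AE z in q. P (fst z)"
  using AE_distrD[of fst q borel P] unfolding couplings_def
  by (auto simp: borel_prod cong: measurable_cong_sets)

lemma AE_coupling_snd:
  "q \<in> couplings \<mu> \<nu> \<Longrightarrow> AE x in \<nu>. P x \<Longrightarrow> AE z in q. P (snd z)"
  using AE_distrD[of snd q borel P] unfolding couplings_def
  by (auto simp: borel_prod cong: measurable_cong_sets)

lemma nn_integral_coupling_fst:
  assumes "q \<in> couplings \<mu> \<nu>" "g \<in> borel_measurable borel"
  shows "(\<integral>\<^sup>+z. g (fst z) \<partial>q) = (\<integral>\<^sup>+x. g x \<partial>\<mu>)"
proof -
  have "fst \<in> q \<rightarrow>\<^sub>M borel" "distr q borel fst = \<mu>"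
    using assms(1) unfolding couplings_def by (auto cong: measurable_cong_sets)
  then show ?thesis using nn_integral_distr[of fst q borel g] assms(2) by auto
qed

lemma nn_integral_coupling_snd:
  assumes "q \<in> couplings \<mu> \<nu>" "g \<in> borel_measurable borel"
  shows "(\<integral>\<^sup>+z. g (snd z) \<partial>q) = (\<integral>\<^sup>+x. g x \<partial>\<nu>)"
proof -
  have "snd \<in> q \<rightarrow>\<^sub>M borel" "distr q borel snd = \<nu>"
    using assms(1) unfolding couplings_def by (auto cong: measurable_cong_sets)
  then show ?thesis using nn_integral_distr[of snd q borel g] assms(2) by auto
qed

lemma integral_coupling_fst:
  fixes g :: "'a::polish_space \<Rightarrow> real"
  assumes "q \<in> couplings \<mu> \<nu>" "g \<in> borel_measurable borel"
  shows "(\<integral>z. g (fst z) \<partial>q) = (\<integral>x. g x \<partial>\<mu>)"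
proof -
  have "fst \<in> q \<rightarrow>\<^sub>M borel" "distr q borel fst = \<mu>"
    using assms(1) unfolding couplings_def by (auto cong: measurable_cong_sets)
  then show ?thesis using integral_distr[of fst q borel g] assms(2) by simp
qed

lemma integral_coupling_snd:
  fixes g :: "'a::polish_space \<Rightarrow> real"
  assumes "q \<in> couplings \<mu> \<nu>" "g \<in> borel_measurable borel"
  shows "(\<integral>z. g (snd z) \<partial>q) = (\<integral>x. g x \<partial>\<nu>)"
proof -
  have "snd \<in> q \<rightarrow>\<^sub>M borel" "distr q borel snd = \<nu>"
    using assms(1) unfolding couplings_def by (auto cong: measurable_cong_sets)
  then show ?thesis using integral_distr[of snd q borel g] assms(2) by simp
qed

section \<open>Localisation of Wasserstein geodesics\<close>

text \<open>
  Without disintegration two couplings with a common marginal can still be glued up to an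
  arbitrarily small error: the middle points are matched at random inside each cell of a countable
  Borel partition into sets of small diameter.
\<close>

lemma approximate_gluing:
  fixes \<mu>0 \<mu> \<mu>1 :: "'a::polish_space measure"
  assumes q1: "q1 \<in> couplings \<mu>0 \<mu>" and q2: "q2 \<in> couplings \<mu> \<mu>1" and e: "e > 0"
  obtains Q where
    "sets Q = sets ((borel \<Otimes>\<^sub>M borel) \<Otimes>\<^sub>M (borel \<Otimes>\<^sub>M borel))"
    "distr Q (borel \<Otimes>\<^sub>M borel) fst = q1" "distr Q (borel \<Otimes>\<^sub>M borel) snd = q2"
    "AE z in Q. dist (snd (fst z)) (fst (snd z)) < e"
proof -
  have s1[measurable_cong]: "sets q1 = sets (borel \<Otimes>\<^sub>M borel)"
    and s2[measurable_cong]: "sets q2 = sets (borel \<Otimes>\<^sub>M borel)"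
    and p1: "prob_space q1" and p2: "prob_space q2"
    and m1: "distr q1 borel snd = \<mu>" and m2: "distr q2 borel fst = \<mu>"
    using q1 q2 by (auto simp: couplings_def)
  have sm[measurable_cong]: "sets \<mu> = sets borel" using m1 by (metis sets_distr)
  have "prob_space \<mu>" unfolding m1[symmetric]
    by (rule prob_space.prob_space_distr[OF p1]) measurable
  then interpret \<mu>: prob_space \<mu> .
  interpret q1: prob_space q1 by fact
  interpret q2: prob_space q2 by fact
  interpret P: pair_sigma_finite q1 q2 ..
  obtain C :: "'a set" where C: "countable C" "\<And>X. open X \<Longrightarrow> X \<noteq> {} \<Longrightarrow> \<exists>d\<in>C. d \<in> X"
    using countable_dense_setE by metis
  have Cne: "C \<noteq> {}" using C(2)[of UNIV] by auto
  define s where "s = from_nat_into C"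
  have ex: "\<exists>n. dist (s n) y < e / 2" for y
  proof -
    obtain d where "d \<in> C" "d \<in> ball y (e / 2)" using C(2)[of "ball y (e / 2)"] e by auto
    then show ?thesis using from_nat_into_surj[OF C(1)] by (metis s_def dist_commute mem_ball)
  qed
  \<comment> \<open>The cell of y is given by the first point of a dense sequence within e / 2, so
    two points of one cell are less than e apart.\<close>
  define idx where "idx y = (LEAST n. dist (s n) y < e / 2)" for y
  have idx_meas[measurable]: "idx \<in> borel \<rightarrow>\<^sub>M count_space UNIV"
    unfolding idx_def by measurable
  have idx_dist: "dist (s (idx y)) y < e / 2" for y
    unfolding idx_def by (rule LeastI_ex[OF ex])
  define w where "w n = emeasure \<mu> {y. idx y = n}" for n
  have wfin: "w n \<noteq> \<infinity>" for n unfolding w_def by (simp add: \<mu>.emeasure_eq_measure)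
  \<comment> \<open>In \<open>ennreal\<close> the inverse of 0 is infinite, so cells of mass zero
    must be discarded; being countably many, they form a null set.\<close>
  have wpos: "AE y in \<mu>. w (idx y) \<noteq> 0"
  proof -
    have "AE y in \<mu>. \<forall>n. w n = 0 \<longrightarrow> idx y \<noteq> n"
    proof (rule AE_all_countable[THEN iffD2], rule allI)
      fix n
      show "AE y in \<mu>. w n = 0 \<longrightarrow> idx y \<noteq> n"
      proof (cases "w n = 0")
        case True
        have "{y. idx y = n} \<in> sets \<mu>"
          using measurable_sets[OF idx_meas, of "{n}"] by (simp add: vimage_def sm)
        then have "AE y in \<mu>. y \<notin> {y. idx y = n}"
          using True unfolding w_def by (intro AE_not_in) (auto simp: null_sets_def)
        then show ?thesis by simp
      qed simp
    qed
    then show ?thesis by eventually_elim auto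
  qed
  \<comment> \<open>Density of the gluing with respect to the product of \<open>q1\<close> and
    \<open>q2\<close>: both middle points must share a cell. Dividing by the mass of the cell makes
    the partial integral over either factor equal to 1, so both marginals come out exactly.\<close>
  define k where "k z = (if idx (snd (fst z)) = idx (fst (snd z))
    then inverse (w (idx (snd (fst z)))) else 0)" for z :: "('a \<times> 'a) \<times> ('a \<times> 'a)"
  have kmeas[measurable]: "k \<in> borel_measurable ((borel \<Otimes>\<^sub>M borel) \<Otimes>\<^sub>M (borel \<Otimes>\<^sub>M borel))"
  proof -
    let ?N = "(borel \<Otimes>\<^sub>M borel) \<Otimes>\<^sub>M (borel \<Otimes>\<^sub>M borel) :: (('a \<times> 'a) \<times> ('a \<times> 'a)) measure"
    have [measurable]: "(\<lambda>z. idx (snd (fst z))) \<in> ?N \<rightarrow>\<^sub>M count_space UNIV"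
      "(\<lambda>z. idx (fst (snd z))) \<in> ?N \<rightarrow>\<^sub>M count_space UNIV"
      by measurable
    have [measurable]: "(\<lambda>z. inverse (w (idx (snd (fst z))))) \<in> borel_measurable ?N"
      by (rule measurable_compose[of "\<lambda>z. idx (snd (fst z))" _ "count_space UNIV"]) auto
    \<comment> \<open>Equality of the two indices as a countable union over their common
      value.\<close>
    have "Measurable.pred ?N (\<lambda>z. \<exists>n. idx (snd (fst z)) = n \<and> idx (fst (snd z)) = n)"
      by measurable
    then have [measurable]: "Measurable.pred ?N (\<lambda>z. idx (snd (fst z)) = idx (fst (snd z)))"
      by (simp add: eq_commute)
    show ?thesis unfolding k_def by measurable
  qed
  have cell: "(\<integral>\<^sup>+y. (if idx y = n then inverse (w n) else 0) \<partial>\<mu>) = 1" if "w n \<noteq> 0" for n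
  proof -
    have "(\<integral>\<^sup>+y. (if idx y = n then inverse (w n) else 0) \<partial>\<mu>)
        = (\<integral>\<^sup>+y. inverse (w n) * indicator {y. idx y = n} y \<partial>\<mu>)"
      by (intro nn_integral_cong) auto
    also have "\<dots> = inverse (w n) * w n"
      unfolding w_def
      by (rule nn_integral_cmult_indicator)
        (use measurable_sets[OF idx_meas, of "{n}"] in \<open>simp add: vimage_def sm\<close>)
    also have "\<dots> = w n / w n" by (simp add: divide_ennreal_def mult.commute)
    also have "\<dots> = 1" using that wfin[of n] by (simp add: ennreal_divide_self less_top)
    finally show ?thesis .
  qed
  define Q where "Q = density (q1 \<Otimes>\<^sub>M q2) k"
  have kq: "k \<in> borel_measurable (q1 \<Otimes>\<^sub>M q2)" by measurable
  have sQ[measurable_cong]: "sets Q = sets ((borel \<Otimes>\<^sub>M borel) \<Otimes>\<^sub>M (borel \<Otimes>\<^sub>M borel))"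
    unfolding Q_def by (simp add: sets_pair_measure_cong[OF s1 s2])
  have kin1: "AE p in q1. (\<integral>\<^sup>+p'. k (p, p') \<partial>q2) = 1"
    using AE_coupling_snd[OF q1 wpos]
  proof eventually_elim
    case (elim p)
    have "(\<integral>\<^sup>+p'. k (p, p') \<partial>q2)
        = (\<integral>\<^sup>+p'. (if idx (fst p') = idx (snd p) then inverse (w (idx (snd p))) else 0) \<partial>q2)"
      by (intro nn_integral_cong) (auto simp: k_def)
    also have "\<dots> = (\<integral>\<^sup>+y. (if idx y = idx (snd p) then inverse (w (idx (snd p))) else 0) \<partial>\<mu>)"
      by (rule nn_integral_coupling_fst[OF q2]) measurable
    finally show ?case using cell[OF elim] by simp
  qed
  have kin2: "AE p' in q2. (\<integral>\<^sup>+p. k (p, p') \<partial>q1) = 1"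
    using AE_coupling_fst[OF q2 wpos]
  proof eventually_elim
    case (elim p')
    have "(\<integral>\<^sup>+p. k (p, p') \<partial>q1)
        = (\<integral>\<^sup>+p. (if idx (snd p) = idx (fst p') then inverse (w (idx (fst p'))) else 0) \<partial>q1)"
      by (intro nn_integral_cong) (auto simp: k_def)
    also have "\<dots> = (\<integral>\<^sup>+y. (if idx y = idx (fst p') then inverse (w (idx (fst p'))) else 0) \<partial>\<mu>)"
      by (rule nn_integral_coupling_snd[OF q1]) measurable
    finally show ?case using cell[OF elim] by simp
  qed
  have d1: "distr Q (borel \<Otimes>\<^sub>M borel) fst = q1"
  proof (rule measure_eqI)
    fix A :: "('a \<times> 'a) set" assume "A \<in> sets (distr Q (borel \<Otimes>\<^sub>M borel) fst)"
    then have A[measurable]: "A \<in> sets (borel \<Otimes>\<^sub>M borel)" by simp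
    have "emeasure (distr Q (borel \<Otimes>\<^sub>M borel) fst) A = (\<integral>\<^sup>+p. indicator A p \<partial>distr Q (borel \<Otimes>\<^sub>M borel) fst)"
      by simp
    also have "\<dots> = (\<integral>\<^sup>+z. indicator A (fst z) \<partial>Q)"
      by (rule nn_integral_distr) measurable
    also have "\<dots> = (\<integral>\<^sup>+z. k z * indicator A (fst z) \<partial>(q1 \<Otimes>\<^sub>M q2))"
      unfolding Q_def by (rule nn_integral_density) measurable
    also have "\<dots> = (\<integral>\<^sup>+p. \<integral>\<^sup>+p'. k (p, p') * indicator A p \<partial>q2 \<partial>q1)"
      by (subst q2.nn_integral_fst[symmetric]) auto
    also have "\<dots> = (\<integral>\<^sup>+p. (\<integral>\<^sup>+p'. k (p, p') \<partial>q2) * indicator A p \<partial>q1)"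
      by (intro nn_integral_cong nn_integral_multc measurable_compose[OF measurable_Pair1' kq])
    also have "\<dots> = (\<integral>\<^sup>+p. indicator A p \<partial>q1)"
      by (rule nn_integral_cong_AE) (use kin1 in eventually_elim, auto)
    finally show "emeasure (distr Q (borel \<Otimes>\<^sub>M borel) fst) A = emeasure q1 A"
      using A s1 by simp
  qed (simp add: s1)
  have d2: "distr Q (borel \<Otimes>\<^sub>M borel) snd = q2"
  proof (rule measure_eqI)
    fix A :: "('a \<times> 'a) set" assume "A \<in> sets (distr Q (borel \<Otimes>\<^sub>M borel) snd)"
    then have A[measurable]: "A \<in> sets (borel \<Otimes>\<^sub>M borel)" by simp
    have "emeasure (distr Q (borel \<Otimes>\<^sub>M borel) snd) A = (\<integral>\<^sup>+p. indicator A p \<partial>distr Q (borel \<Otimes>\<^sub>M borel) snd)"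
      by simp
    also have "\<dots> = (\<integral>\<^sup>+z. indicator A (snd z) \<partial>Q)"
      by (rule nn_integral_distr) measurable
    also have "\<dots> = (\<integral>\<^sup>+z. k z * indicator A (snd z) \<partial>(q1 \<Otimes>\<^sub>M q2))"
      unfolding Q_def by (rule nn_integral_density) measurable
    also have "\<dots> = (\<integral>\<^sup>+p'. \<integral>\<^sup>+p. k (p, p') * indicator A p' \<partial>q1 \<partial>q2)"
      by (subst P.nn_integral_snd[symmetric]) auto
    also have "\<dots> = (\<integral>\<^sup>+p'. (\<integral>\<^sup>+p. k (p, p') \<partial>q1) * indicator A p' \<partial>q2)"
      by (intro nn_integral_cong nn_integral_multc measurable_compose[OF measurable_Pair2' kq])
    also have "\<dots> = (\<integral>\<^sup>+p. indicator A p \<partial>q2)"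
      by (rule nn_integral_cong_AE) (use kin2 in eventually_elim, auto)
    finally show "emeasure (distr Q (borel \<Otimes>\<^sub>M borel) snd) A = emeasure q2 A"
      using A s2 by simp
  qed (simp add: s2)
  have "AE z in Q. dist (snd (fst z)) (fst (snd z)) < e"
    unfolding Q_def
  proof (subst AE_density)
    show "AE z in q1 \<Otimes>\<^sub>M q2. 0 < k z \<longrightarrow> dist (snd (fst z)) (fst (snd z)) < e"
    proof (rule AE_I2, rule impI)
      fix z assume "0 < k z"
      then have i: "idx (snd (fst z)) = idx (fst (snd z))" by (auto simp: k_def split: if_splits)
      have "dist (snd (fst z)) (fst (snd z)) \<le>
          dist (s (idx (snd (fst z)))) (snd (fst z)) + dist (s (idx (fst (snd z)))) (fst (snd z))"
        unfolding i by (metis dist_commute dist_triangle)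
      then show "dist (snd (fst z)) (fst (snd z)) < e"
        using idx_dist[of "snd (fst z)"] idx_dist[of "fst (snd z)"] by linarith
    qed
  qed measurable
  with that sQ d1 d2 show ?thesis by blast
qed

text \<open>Here a and b are the legs of a path broken at time t, c the direct distance, e the
  gluing error and D the diameter. The right side is s^2 plus a penalty u^2 / (t (1 - t)) \<ge> 4
  u^2 for not splitting the length s in the ratio t : 1 - t. A first leg longer than t D forces an
  unfair split or s > D, and either one costs at least the square of the excess.\<close>

lemma interpolation_defect:
  fixes a b c e t D :: real
  assumes "0 \<le> a" "0 \<le> b" "0 \<le> c" "0 \<le> e" "0 < t" "t \<le> 1/2"
    and c: "c \<le> a + b + e" "c \<le> D"
  shows "c\<^sup>2 + (max (a - t * D) 0)\<^sup>2 \<le> a\<^sup>2 / t + b\<^sup>2 / (1 - t) + 2 * e * D"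
proof -
  define s where "s = a + b"
  define u where "u = a - t * s"
  have t1: "0 < t * (1 - t)" using assms by simp
  have t2: "t * (1 - t) \<le> 1/4"
    using zero_le_power2[of "t - 1/2"] by (simp add: power2_eq_square algebra_simps)
  have id: "a\<^sup>2 / t + b\<^sup>2 / (1 - t) = s\<^sup>2 + u\<^sup>2 / (t * (1 - t))"
    using assms unfolding s_def u_def by (simp add: divide_simps) algebra
  have "4 * u\<^sup>2 * (t * (1 - t)) \<le> 4 * u\<^sup>2 * (1/4)" by (intro mult_left_mono t2) auto
  then have u4: "4 * u\<^sup>2 \<le> u\<^sup>2 / (t * (1 - t))" using t1 by (simp add: pos_le_divide_eq)
  \<comment> \<open>Replacing c by this value changes the square by at most 2 e D, because c exceeds
    it by at most e and both are at most D.\<close>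
  define c' where "c' = min s D"
  have c'0: "0 \<le> c'" using assms by (simp add: c'_def s_def)
  have "c \<le> c' + e" using assms by (simp add: c'_def s_def)
  moreover have "c' \<le> D" by (simp add: c'_def)
  ultimately have "(c - c') * (c + c') \<le> e * (2 * D)"
    using assms c'0 by (intro order.trans[OF mult_right_mono[of "c - c'" e "c + c'"] mult_left_mono]) auto
  then have cc: "c\<^sup>2 \<le> c'\<^sup>2 + 2 * e * D" by (simp add: power2_eq_square algebra_simps)
  have "c'\<^sup>2 + (max (a - t * D) 0)\<^sup>2 \<le> s\<^sup>2 + 4 * u\<^sup>2"
  proof (cases "s \<le> D")
    case True
    have "a - t * D \<le> u" using True assms by (simp add: u_def mult_left_mono)
    then have "max (a - t * D) 0 \<le> \<bar>u\<bar>" by auto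
    then have "(max (a - t * D) 0)\<^sup>2 \<le> u\<^sup>2" by (metis max.cobounded2 power2_abs power_mono)
    also have "\<dots> \<le> 4 * u\<^sup>2" by simp
    finally show ?thesis using True by (simp add: c'_def)
  next
    case False
    \<comment> \<open>A broken path longer than D already pays s^2 - D^2 \<ge> v^2, which absorbs
      the part t v of the excess a - t D.\<close>
    define v where "v = s - D"
    have v: "v > 0" "D \<ge> 0" using False assms by (auto simp: v_def)
    have "a - t * D = u + t * v" by (simp add: u_def v_def algebra_simps)
    moreover have "t * v \<le> v / 2" using v assms by (simp add: mult_right_mono[of t "1/2" v, simplified])
    ultimately have "a - t * D \<le> \<bar>u\<bar> + v / 2" by linarith
    then have "max (a - t * D) 0 \<le> \<bar>u\<bar> + v / 2" using v by simp
    then have "(max (a - t * D) 0)\<^sup>2 \<le> (\<bar>u\<bar> + v / 2)\<^sup>2" by (intro power_mono) auto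
    also have "\<dots> = 2 * u\<^sup>2 + v\<^sup>2 / 2 - (\<bar>u\<bar> - v / 2)\<^sup>2"
      by (simp add: power2_eq_square field_simps)
    also have "\<dots> \<le> 4 * u\<^sup>2 + v\<^sup>2"
      using zero_le_power2[of "\<bar>u\<bar> - v / 2"] zero_le_power2[of u] zero_le_power2[of v] by linarith
    finally have "(max (a - t * D) 0)\<^sup>2 \<le> 4 * u\<^sup>2 + v\<^sup>2" .
    moreover have "s\<^sup>2 = v\<^sup>2 + D\<^sup>2 + 2 * (v * D)" by (simp add: v_def power2_eq_square algebra_simps)
    moreover have "v * D \<ge> 0" using v by simp
    moreover have "c' = D" using False by (simp add: c'_def)
    ultimately show ?thesis by simp
  qed
  then show ?thesis using id u4 cc by linarith
qed

text \<open>Gluing the two legs gives a competitor for the pair of end measures, so its cost is at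
  least W^2, while the weighted costs of the legs add up to exactly W^2. There is no room for a
  defect: the squared excess over t D has integral at most 2 e D for every gluing error e, hence it
  vanishes almost everywhere.\<close>

lemma dist_le_of_interpolation:
  fixes \<mu>0 \<mu> \<mu>1 :: "'a::polish_space measure"
  assumes q1: "q1 \<in> couplings \<mu>0 \<mu>" and q2: "q2 \<in> couplings \<mu> \<mu>1"
    and t: "0 < t" "t \<le> 1/2"
    and S: "AE x in \<mu>0. x \<in> S" "AE x in \<mu>. x \<in> S" "AE x in \<mu>1. x \<in> S"
    and D: "\<And>x y. x \<in> S \<Longrightarrow> y \<in> S \<Longrightarrow> dist x y \<le> D" "D \<ge> 0"
    and c1: "transport_cost q1 = (t * W)\<^sup>2" and c2: "transport_cost q2 = ((1 - t) * W)\<^sup>2"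
    and opt: "\<And>q. q \<in> couplings \<mu>0 \<mu>1 \<Longrightarrow> W\<^sup>2 \<le> transport_cost q"
  shows "AE z in q1. dist (fst z) (snd z) \<le> t * D"
proof -
  have s1[measurable_cong]: "sets q1 = sets (borel \<Otimes>\<^sub>M borel)"
    and s2[measurable_cong]: "sets q2 = sets (borel \<Otimes>\<^sub>M borel)"
    and p1: "prob_space q1" and p2: "prob_space q2"
    and m1: "distr q1 borel fst = \<mu>0" and m2: "distr q2 borel snd = \<mu>1"
    using q1 q2 by (auto simp: couplings_def)
  interpret q1: prob_space q1 by fact
  interpret q2: prob_space q2 by fact
  define \<phi> where "\<phi> z = (max (dist (fst z) (snd z) - t * D) 0)\<^sup>2" for z :: "'a \<times> 'a"
  have \<phi>m[measurable]: "\<phi> \<in> borel_measurable (borel \<Otimes>\<^sub>M borel)" unfolding \<phi>_def by measurable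
  have AE1: "AE z in q1. dist (fst z) (snd z) \<le> D"
    using AE_coupling_fst[OF q1 S(1)] AE_coupling_snd[OF q1 S(2)] by eventually_elim (rule D(1))
  have AE2: "AE z in q2. dist (fst z) (snd z) \<le> D"
    using AE_coupling_fst[OF q2 S(2)] AE_coupling_snd[OF q2 S(3)] by eventually_elim (rule D(1))
  have i1: "integrable q1 (\<lambda>z. (dist (fst z) (snd z))\<^sup>2)"
    by (rule q1.integrable_const_bound[of _ "D\<^sup>2"])
      (use AE1 in eventually_elim, auto intro!: power_mono)
  have i2: "integrable q2 (\<lambda>z. (dist (fst z) (snd z))\<^sup>2)"
    by (rule q2.integrable_const_bound[of _ "D\<^sup>2"])
      (use AE2 in eventually_elim, auto intro!: power_mono)
  have \<phi>0: "\<phi> z \<ge> 0" for z unfolding \<phi>_def by simp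
  have i\<phi>: "integrable q1 \<phi>"
  proof (rule q1.integrable_const_bound[of _ "D\<^sup>2"])
    have tD: "t * D \<ge> 0" using t D by simp
    show "AE z in q1. norm (\<phi> z) \<le> D\<^sup>2"
      using AE1 by eventually_elim (use tD D(2) in \<open>auto simp: \<phi>_def intro!: power_mono\<close>)
  qed measurable
  have main: "(\<integral>z. \<phi> z \<partial>q1) \<le> 2 * e * D" if e: "e > 0" for e
  proof -
    obtain Q where sQ[measurable_cong]: "sets Q = sets ((borel \<Otimes>\<^sub>M borel) \<Otimes>\<^sub>M (borel \<Otimes>\<^sub>M borel))"
      and d1: "distr Q (borel \<Otimes>\<^sub>M borel) fst = q1" and d2: "distr Q (borel \<Otimes>\<^sub>M borel) snd = q2"
      and near: "AE z in Q. dist (snd (fst z)) (fst (snd z)) < e"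
      using approximate_gluing[OF q1 q2 e] .
    have "emeasure (distr Q (borel \<Otimes>\<^sub>M borel) fst) (space (borel \<Otimes>\<^sub>M borel))
        = emeasure Q (fst -` space (borel \<Otimes>\<^sub>M borel) \<inter> space Q)"
      by (rule emeasure_distr[OF _ sets.top]) measurable
    also have "fst -` space (borel \<Otimes>\<^sub>M borel) \<inter> space Q = space Q"
      by (auto simp: space_pair_measure)
    finally have pQ: "prob_space Q"
      using q1.emeasure_space_1 sets_eq_imp_space_eq[OF s1] by (intro prob_spaceI) (simp add: d1)
    interpret Q: prob_space Q by fact
    define q where "q = distr Q (borel \<Otimes>\<^sub>M borel) (\<lambda>z. (fst (fst z), snd (snd z)))"
    have "distr q borel fst = distr Q borel (\<lambda>z. fst (fst z))"
      unfolding q_def by (subst distr_distr) (auto simp: comp_def)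
    also have "\<dots> = distr q1 borel fst"
      unfolding d1[symmetric] by (subst distr_distr) (auto simp: comp_def)
    finally have qf: "distr q borel fst = \<mu>0" using m1 by simp
    have "distr q borel snd = distr Q borel (\<lambda>z. snd (snd z))"
      unfolding q_def by (subst distr_distr) (auto simp: comp_def)
    also have "\<dots> = distr q2 borel snd"
      unfolding d2[symmetric] by (subst distr_distr) (auto simp: comp_def)
    finally have qs: "distr q borel snd = \<mu>1" using m2 by simp
    have pq: "prob_space q" unfolding q_def by (rule Q.prob_space_distr) measurable
    have qc: "q \<in> couplings \<mu>0 \<mu>1"
      using pq qf qs unfolding couplings_def by (auto simp: q_def)
    have cq: "transport_cost q = (\<integral>z. (dist (fst (fst z)) (snd (snd z)))\<^sup>2 \<partial>Q)"
      unfolding transport_cost_def q_def by (subst integral_distr) auto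
    have A1: "AE z in Q. fst (fst z) \<in> S \<and> snd (fst z) \<in> S"
    proof -
      have "AE p in q1. fst p \<in> S \<and> snd p \<in> S"
        using AE_coupling_fst[OF q1 S(1)] AE_coupling_snd[OF q1 S(2)] by eventually_elim simp
      then show ?thesis unfolding d1[symmetric] by (rule AE_distrD[rotated]) measurable
    qed
    have A2: "AE z in Q. fst (snd z) \<in> S \<and> snd (snd z) \<in> S"
    proof -
      have "AE p in q2. fst p \<in> S \<and> snd p \<in> S"
        using AE_coupling_fst[OF q2 S(2)] AE_coupling_snd[OF q2 S(3)] by eventually_elim simp
      then show ?thesis unfolding d2[symmetric] by (rule AE_distrD[rotated]) measurable
    qed
    have I1: "integrable Q (\<lambda>z. (dist (fst (fst z)) (snd (fst z)))\<^sup>2)"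
      and V1: "(\<integral>z. (dist (fst (fst z)) (snd (fst z)))\<^sup>2 \<partial>Q) = (t * W)\<^sup>2"
      using i1 c1 unfolding transport_cost_def
      by (auto simp: d1[symmetric] integral_distr integrable_distr_eq)
    have I2: "integrable Q (\<lambda>z. (dist (fst (snd z)) (snd (snd z)))\<^sup>2)"
      and V2: "(\<integral>z. (dist (fst (snd z)) (snd (snd z)))\<^sup>2 \<partial>Q) = ((1 - t) * W)\<^sup>2"
      using i2 c2 unfolding transport_cost_def
      by (auto simp: d2[symmetric] integral_distr integrable_distr_eq)
    have I\<phi>: "integrable Q (\<lambda>z. \<phi> (fst z))" and V\<phi>: "(\<integral>z. \<phi> (fst z) \<partial>Q) = (\<integral>z. \<phi> z \<partial>q1)"
      using i\<phi> by (auto simp: d1[symmetric] integral_distr integrable_distr_eq)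
    have Iq: "integrable Q (\<lambda>z. (dist (fst (fst z)) (snd (snd z)))\<^sup>2)"
      by (rule Q.integrable_const_bound[of _ "D\<^sup>2"])
        (use A1 A2 in eventually_elim, auto intro!: power_mono D(1))
    have "(\<integral>z. (dist (fst (fst z)) (snd (snd z)))\<^sup>2 + \<phi> (fst z) \<partial>Q)
      \<le> (\<integral>z. (dist (fst (fst z)) (snd (fst z)))\<^sup>2 / t + (dist (fst (snd z)) (snd (snd z)))\<^sup>2 / (1 - t)
            + 2 * e * D \<partial>Q)"
    proof (rule integral_mono_AE)
      show "AE z in Q. (dist (fst (fst z)) (snd (snd z)))\<^sup>2 + \<phi> (fst z)
        \<le> (dist (fst (fst z)) (snd (fst z)))\<^sup>2 / t + (dist (fst (snd z)) (snd (snd z)))\<^sup>2 / (1 - t)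
            + 2 * e * D"
        using A1 A2 near
      proof eventually_elim
        case (elim z)
        have "dist (fst (fst z)) (snd (snd z))
          \<le> dist (fst (fst z)) (snd (fst z)) + dist (snd (fst z)) (snd (snd z))"
          by (rule dist_triangle)
        also have "dist (snd (fst z)) (snd (snd z))
          \<le> dist (snd (fst z)) (fst (snd z)) + dist (fst (snd z)) (snd (snd z))"
          by (rule dist_triangle)
        finally show ?case
          unfolding \<phi>_def using elim e t D
          by (intro interpolation_defect) auto
      qed
    qed (use I1 I2 I\<phi> Iq in auto)
    also have "\<dots> = (t * W)\<^sup>2 / t + ((1 - t) * W)\<^sup>2 / (1 - t) + 2 * e * D"
      using I1 I2 V1 V2 by (simp add: Q.prob_space)
    also have "\<dots> = W\<^sup>2 + 2 * e * D" using t by (simp add: power2_eq_square field_simps)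
    finally have "transport_cost q + (\<integral>z. \<phi> z \<partial>q1) \<le> W\<^sup>2 + 2 * e * D"
      using Iq I\<phi> V\<phi> by (simp add: cq)
    with opt[OF qc] show ?thesis by linarith
  qed
  have "(\<integral>z. \<phi> z \<partial>q1) \<le> 0"
  proof (rule field_le_epsilon)
    fix e :: real assume "e > 0"
    have "2 * (e / (2 * D + 1)) * D \<le> e" using D(2) \<open>e > 0\<close> by (simp add: field_simps)
    then show "(\<integral>z. \<phi> z \<partial>q1) \<le> 0 + e" using main[of "e / (2 * D + 1)"] \<open>e > 0\<close> D(2) by simp
  qed
  moreover have "(\<integral>z. \<phi> z \<partial>q1) \<ge> 0" by (simp add: \<phi>_def)
  ultimately have "(\<integral>z. \<phi> z \<partial>q1) = 0" by linarith
  then have "AE z in q1. \<phi> z = 0"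
    using integral_nonneg_eq_0_iff_AE[OF i\<phi>] by (simp add: \<phi>0)
  then show ?thesis by eventually_elim (auto simp: \<phi>_def max_def split: if_splits)
qed

section \<open>Slopes at a positive scale\<close>

text \<open>The descending slope before its limit in r. Unlike the slope itself it controls the
  actual decrease of f over every distance below r, which is what a coupling at positive time
  requires.\<close>

definition slope_at_scale :: "('a::metric_space \<Rightarrow> real) \<Rightarrow> real \<Rightarrow> 'a \<Rightarrow> ennreal" where
  "slope_at_scale f r x = (SUP y\<in>ball x r - {x}. ennreal (max (f x - f y) 0 / dist x y))"

lemma desc_slope_eq_INF: "desc_slope f x = (INF r\<in>{0<..}. slope_at_scale f r x)"
  unfolding desc_slope_def slope_at_scale_def Limsup_within by simp

lemma slope_at_scale_mono: "r \<le> s \<Longrightarrow> slope_at_scale f r x \<le> slope_at_scale f s x"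
  unfolding slope_at_scale_def by (intro SUP_subset_mono) auto

lemma slope_at_scale_LIMSEQ: "(\<lambda>i. slope_at_scale f (1 / real (Suc i)) x) \<longlonglongrightarrow> desc_slope f x"
proof -
  have "decseq (\<lambda>i. slope_at_scale f (1 / real (Suc i)) x)"
    by (intro decseq_SucI slope_at_scale_mono) (simp add: field_simps)
  then have "(\<lambda>i. slope_at_scale f (1 / real (Suc i)) x) \<longlonglongrightarrow> (INF i. slope_at_scale f (1 / real (Suc i)) x)"
    by (rule LIMSEQ_INF)
  moreover have "(INF i. slope_at_scale f (1 / real (Suc i)) x) = desc_slope f x"
    unfolding desc_slope_eq_INF
  proof (rule antisym)
    show "(INF i. slope_at_scale f (1 / real (Suc i)) x) \<le> (INF r\<in>{0<..}. slope_at_scale f r x)"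
    proof (rule INF_greatest)
      fix r :: real assume "r \<in> {0<..}"
      then obtain i where "1 / real (Suc i) < r" using nat_approx_posE by auto
      then show "(INF i. slope_at_scale f (1 / real (Suc i)) x) \<le> slope_at_scale f r x"
        by (intro INF_lower2[of i] slope_at_scale_mono) auto
    qed
    show "(INF r\<in>{0<..}. slope_at_scale f r x) \<le> (INF i. slope_at_scale f (1 / real (Suc i)) x)"
      by (rule INF_greatest) (rule INF_lower, simp)
  qed
  ultimately show ?thesis by simp
qed

text \<open>Lower semicontinuity: a point y witnessing that the supremum at x exceeds c also does so
  for all points near x, as the difference quotient to the fixed y is continuous away from
  y.\<close>

lemma slope_at_scale_measurable:
  assumes "continuous_on UNIV f"
  shows "slope_at_scale f r \<in> borel_measurable borel"
proof (rule borel_measurableI_greater)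
  fix c
  have "open {x. c < slope_at_scale f r x}"
  proof (rule Topological_Spaces.openI)
    fix x assume "x \<in> {x. c < slope_at_scale f r x}"
    then obtain y where y: "y \<in> ball x r - {x}" "c < ennreal (max (f x - f y) 0 / dist x y)"
      unfolding slope_at_scale_def mem_Collect_eq less_SUP_iff by blast
    define g where "g z = ennreal (max (f z - f y) 0 / dist z y)" for z
    have fz: "(f \<longlongrightarrow> f x) (at x)" using assms by (simp add: continuous_on_eq_continuous_at isContD)
    have "(g \<longlongrightarrow> g x) (at x)"
      unfolding g_def using y fz by (intro tendsto_intros) auto
    then have "(g \<longlongrightarrow> g x) (nhds x)" by (simp add: tendsto_at_iff_tendsto_nhds)
    moreover have "c < g x" using y(2) by (simp add: g_def)
    ultimately have "\<forall>\<^sub>F z in nhds x. c < g z" by (rule order_tendstoD(1))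
    moreover have "\<forall>\<^sub>F z in nhds x. z \<in> ball y r - {y}"
      using y by (intro eventually_nhds_in_open) (auto simp: dist_commute open_Diff)
    ultimately have "\<forall>\<^sub>F z in nhds x. c < slope_at_scale f r z"
    proof eventually_elim
      case (elim z)
      have "g z \<le> slope_at_scale f r z"
        unfolding slope_at_scale_def g_def using elim by (intro SUP_upper) (auto simp: dist_commute)
      then show ?case using elim by (auto intro: less_le_trans)
    qed
    then show "\<exists>T. open T \<and> x \<in> T \<and> T \<subseteq> {x. c < slope_at_scale f r x}"
      by (auto simp: eventually_nhds)
  qed
  then show "{x \<in> space borel. c < slope_at_scale f r x} \<in> sets borel" by simp
qed

lemma slope_at_scale_le_lipschitz:
  assumes "L-lipschitz_on UNIV f"
  shows "slope_at_scale f r x \<le> ennreal L"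
  unfolding slope_at_scale_def
proof (intro SUP_least ennreal_leI)
  fix y assume y: "y \<in> ball x r - {x}"
  have "\<bar>f x - f y\<bar> \<le> L * dist x y" using lipschitz_onD[OF assms, of x y] by (simp add: dist_real_def)
  moreover have "0 \<le> L" using assms by (rule lipschitz_on_nonneg)
  ultimately show "max (f x - f y) 0 / dist x y \<le> L" using y by (auto simp: field_simps max_def)
qed

text \<open>
  The bound on the decrease of \<open>f\<close> beyond the scale \<open>r\<close> is quadratic in the distance, hence of
  second order in time along a geodesic.
\<close>

lemma decrease_le_slope:
  fixes f :: "'a::metric_space \<Rightarrow> real"
  assumes L: "L-lipschitz_on UNIV f" and r: "r > 0" and s: "s > 0"
  shows "max (f x - f y) 0 \<le> s / 2 * (enn2real (slope_at_scale f r x))\<^sup>2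
    + (dist x y)\<^sup>2 / (2 * s) + L * (dist x y)\<^sup>2 / r"
proof -
  let ?G = "enn2real (slope_at_scale f r x)" and ?d = "dist x y"
  have L0: "0 \<le> L" using L by (rule lipschitz_on_nonneg)
  have Ld: "\<bar>f x - f y\<bar> \<le> L * ?d" using lipschitz_onD[OF L, of x y] by (simp add: dist_real_def)
  show ?thesis
  proof (cases "?d < r")
    case True
    have "max (f x - f y) 0 \<le> ?G * ?d"
    proof (cases "x = y")
      case False
      have "ennreal (max (f x - f y) 0 / ?d) \<le> slope_at_scale f r x"
        unfolding slope_at_scale_def using True False by (intro SUP_upper) auto
      moreover have "slope_at_scale f r x = ennreal ?G"
        using slope_at_scale_le_lipschitz[OF L, of r x] by (metis ennreal_enn2real ennreal_less_top le_less_trans)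
      ultimately have "max (f x - f y) 0 / ?d \<le> ?G" by (metis ennreal_le_iff enn2real_nonneg)
      then show ?thesis using False by (simp add: field_simps)
    qed simp
    also have "?G * ?d \<le> s / 2 * ?G\<^sup>2 + ?d\<^sup>2 / (2 * s)"
    proof -
      have "s / 2 * ?G\<^sup>2 + ?d\<^sup>2 / (2 * s) - ?G * ?d = (s * ?G - ?d)\<^sup>2 / (2 * s)"
        using s by (simp add: field_simps power2_eq_square)
      moreover have "\<dots> \<ge> 0" using s by simp
      ultimately show ?thesis by linarith
    qed
    also have "\<dots> \<le> \<dots> + L * ?d\<^sup>2 / r" using L0 r by simp
    finally show ?thesis .
  next
    case False
    have "max (f x - f y) 0 \<le> L * ?d * 1" using Ld L0 by auto
    also have "\<dots> \<le> L * ?d * (?d / r)" using False r L0 by (intro mult_left_mono) auto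
    also have "\<dots> = L * ?d\<^sup>2 / r" by (simp add: power2_eq_square)
    finally show ?thesis using s by (simp add: add_increasing)
  qed
qed

text \<open>Truncation is monotone and 1-Lipschitz, so it shrinks every decrease of f. This holds at
  each point, whereas almost everywhere equality of two functions would not compare their
  slopes.\<close>

lemma desc_slope_clip_le: "desc_slope (\<lambda>x. max (- F) (min F (f x))) x \<le> desc_slope f x"
  unfolding desc_slope_def
  by (intro Limsup_mono always_eventually allI ennreal_leI divide_right_mono) auto

section \<open>Power functions near 1\<close>

text \<open>Concavity, with \<open>h powr (a - 1) * h\<close> contracted to \<open>h powr a\<close>.
  In the application r is the unknown density at time t, which thereby enters linearly, and h is the
  initial density. The derivative test lives on the positive reals, so r = 0 is a separate
  case.\<close>

lemma powr_le_tangent: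
  fixes r h a :: real
  assumes "r \<ge> 0" "h > 0" "0 < a" "a < 1"
  shows "r powr a \<le> (1 - a) * h powr a + a * h powr (a - 1) * r"
proof (cases "r = 0")
  case False
  have "(- (a * h powr (a - 1))) * (r - h) \<le> - (r powr a) - - (h powr a)"
    by (rule f''_imp_f'[where C = "{0<..}" and f = "\<lambda>x. - (x powr a)"
          and f' = "\<lambda>x. - (a * x powr (a - 1))"
          and f'' = "\<lambda>x. a * (1 - a) * x powr (a - 2)"])
      (use assms False in \<open>auto intro!: derivative_eq_intros simp: algebra_simps\<close>)
  moreover have "h powr (a - 1) * h = h powr a"
    using assms powr_add[of h "a - 1" 1] by simp
  ultimately show ?thesis by (simp add: algebra_simps)
qed (use assms in simp)

text \<open>The difference of the two sides vanishes to first order at 1 and is convex up to 1 + d,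
  since there \<open>u powr (a - 2)\<close> is at least (1 + d)^(-2). Weakening the exponent a - 2
  to -2 keeps the constant free of powers depending on a.\<close>

lemma powr_le_quadratic:
  fixes u a d :: real
  assumes "0 < u" "u \<le> 1 + d" "0 \<le> d" "0 < a" "a < 1"
  shows "u powr a \<le> 1 + a * (u - 1) - a * (1 - a) / (2 * (1 + d)\<^sup>2) * (u - 1)\<^sup>2"
proof -
  define c where "c = a * (1 - a) / (1 + d)\<^sup>2"
  define g where "g u = 1 + a * (u - 1) - c / 2 * (u - 1)\<^sup>2 - u powr a" for u
  have "(a - c * (1 - 1) - a * 1 powr (a - 1)) * (u - 1) \<le> g u - g 1"
  proof (rule f''_imp_f'[where C = "{0<..1 + d}" and f' = "\<lambda>u. a - c * (u - 1) - a * u powr (a - 1)"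
        and f'' = "\<lambda>u. - c + a * (1 - a) * u powr (a - 2)"])
    fix v :: real assume v: "v \<in> {0<..1 + d}"
    show "(g has_real_derivative a - c * (v - 1) - a * v powr (a - 1)) (at v)"
      unfolding g_def using v
      by (auto intro!: derivative_eq_intros simp: field_simps power2_eq_square)
    show "((\<lambda>u. a - c * (u - 1) - a * u powr (a - 1)) has_real_derivative
        - c + a * (1 - a) * v powr (a - 2)) (at v)"
      using v by (auto intro!: derivative_eq_intros simp: algebra_simps)
    have "inverse ((1 + d)\<^sup>2) = (1 + d) powr (-2)"
      using assms by (simp add: powr_minus powr_numeral)
    also have "\<dots> \<le> (1 + d) powr (a - 2)" using assms by (intro powr_mono) auto
    also have "\<dots> \<le> v powr (a - 2)" using v assms by (intro powr_mono2') auto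
    finally have "a * (1 - a) * inverse ((1 + d)\<^sup>2) \<le> a * (1 - a) * v powr (a - 2)"
      using assms by (intro mult_left_mono) auto
    then show "0 \<le> - c + a * (1 - a) * v powr (a - 2)" by (simp add: c_def divide_inverse)
  qed (use assms in auto)
  then show ?thesis by (simp add: g_def c_def)
qed

text \<open>Convexity bounds the increase by the tangent at u, and u \<ge> 1 - d bounds the
  derivative there. If u > v the left side is not positive; so only decreases from v to u
  count.\<close>

lemma powr_minus_diff_le:
  fixes u v b d :: real
  assumes "1 - d \<le> u" "0 < v" "0 \<le> d" "d < 1" "0 < b" "b \<le> 1"
  shows "u powr (- b) - v powr (- b) \<le> b / (1 - d)\<^sup>2 * max (v - u) 0"
proof (cases "u \<le> v")
  case True
  have u: "u > 0" using assms by linarith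
  have "(- b * u powr (- b - 1)) * (v - u) \<le> v powr (- b) - u powr (- b)"
    by (rule f''_imp_f'[where C = "{0<..}" and f = "\<lambda>x. x powr (- b)"
          and f' = "\<lambda>x. - b * x powr (- b - 1)"
          and f'' = "\<lambda>x. b * (b + 1) * x powr (- b - 2)"])
      (use assms u in \<open>auto intro!: derivative_eq_intros simp: algebra_simps\<close>)
  then have "u powr (- b) - v powr (- b) \<le> b * u powr (- b - 1) * (v - u)" by simp
  also have "u powr (- b - 1) \<le> 1 / (1 - d)\<^sup>2"
  proof -
    have "u powr (- b - 1) \<le> (1 - d) powr (- b - 1)" using assms by (intro powr_mono2') auto
    also have "\<dots> \<le> (1 - d) powr (-2)" using assms by (intro powr_mono') auto
    also have "\<dots> = 1 / (1 - d)\<^sup>2"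
      using assms by (simp add: powr_minus powr_numeral divide_inverse)
    finally show ?thesis .
  qed
  then have "b * u powr (- b - 1) * (v - u) \<le> b * (1 / (1 - d)\<^sup>2) * (v - u)"
    using assms True by (intro mult_right_mono mult_left_mono) auto
  finally show ?thesis using True by simp
next
  case False
  then have "u powr (- b) \<le> v powr (- b)" using assms by (intro powr_mono2') auto
  then show ?thesis using False by simp
qed

lemma powr_minus_ge:
  fixes u b d :: real
  assumes "0 < u" "u \<le> 1 + d" "0 \<le> d" "0 < b" "b \<le> 1"
  shows "1 / (1 + d) \<le> u powr (- b)"
proof -
  have "1 / (1 + d) = (1 + d) powr (- 1)" using assms by (simp add: powr_minus_divide)
  also have "\<dots> \<le> (1 + d) powr (- b)" using assms by (intro powr_mono) auto
  also have "\<dots> \<le> u powr (- b)" using assms by (intro powr_mono2') auto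
  finally show ?thesis .
qed

text \<open>With a = 1 - 1 / n the normalisation by V becomes a factor
  \<open>V powr (1 / n)\<close>, which occurs on both sides of the entropy inequality and
  cancels.\<close>

lemma powr_divide_scale:
  fixes V h a :: real
  assumes "V > 0" "h > 0"
  shows "(h / V) powr a = V powr (1 - a) * (h powr a / V)"
    "(h / V) powr (a - 1) = V powr (1 - a) * h powr (a - 1)"
proof -
  have *: "V powr (1 - a) = V / V powr a" "V powr (a - 1) = V powr a / V"
    using assms by (simp_all add: powr_diff)
  have V: "V powr a \<noteq> 0" using assms by simp
  show "(h / V) powr a = V powr (1 - a) * (h powr a / V)"
    unfolding powr_divide * using assms V by (simp add: powr_divide)
  have "(h / V) powr (a - 1) = h powr (a - 1) / V powr (a - 1)"
    using assms by (simp add: powr_divide)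
  then show "(h / V) powr (a - 1) = V powr (1 - a) * h powr (a - 1)"
    unfolding * by simp
qed

section \<open>Distortion coefficients\<close>

lemma sin_scaled_ge:
  fixes s x :: real
  assumes "0 \<le> s" "s \<le> 1" "0 \<le> x" "x \<le> pi"
  shows "s * sin x \<le> sin (s * x)"
proof -
  have "concave_on {0..pi} sin"
    by (rule f''_le0_imp_concave[where f' = cos and f'' = "\<lambda>x. - sin x"])
      (auto intro!: derivative_eq_intros sin_ge_zero)
  then have "convex_on {0..pi} (\<lambda>x. - sin x)" by (simp add: concave_on_def)
  from convex_onD[OF this, of s 0 x] assms show ?thesis by simp
qed

text \<open>
  As functions of \<open>s\<close> both sides agree at \<open>0\<close> and \<open>1\<close>, and by the previous lemma their difference
  is concave.
\<close>

lemma sin_scaled_ge_quadratic: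
  fixes s x :: real
  assumes s: "0 \<le> s" "s \<le> 1" and x: "0 \<le> x" "x \<le> pi"
  shows "s * (1 + (1 - s\<^sup>2) * x\<^sup>2 / 6) * sin x \<le> sin (s * x)"
proof -
  define g where "g s = sin (s * x) - s * (1 + (1 - s\<^sup>2) * x\<^sup>2 / 6) * sin x" for s
  have "concave_on {0..1} g"
  proof (rule f''_le0_imp_concave[where f' = "\<lambda>s. x * cos (s * x) - (1 + (1 - 3 * s\<^sup>2) * x\<^sup>2 / 6) * sin x"
        and f'' = "\<lambda>s. - x\<^sup>2 * (sin (s * x) - s * sin x)"])
    fix s :: real assume s: "s \<in> {0..1}"
    show "(g has_real_derivative x * cos (s * x) - (1 + (1 - 3 * s\<^sup>2) * x\<^sup>2 / 6) * sin x) (at s)"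
      unfolding g_def
      by (auto intro!: derivative_eq_intros) (simp add: power2_eq_square field_simps)
    show "((\<lambda>s. x * cos (s * x) - (1 + (1 - 3 * s\<^sup>2) * x\<^sup>2 / 6) * sin x)
        has_real_derivative - x\<^sup>2 * (sin (s * x) - s * sin x)) (at s)"
      by (auto intro!: derivative_eq_intros) (simp add: power2_eq_square field_simps)
    show "- x\<^sup>2 * (sin (s * x) - s * sin x) \<le> 0"
      using sin_scaled_ge[of s x] s x by (simp add: mult_nonneg_nonneg)
  qed simp
  then have "convex_on {0..1} (\<lambda>s. - g s)" by (simp add: concave_on_def)
  from convex_onD[OF this, of s 0 1] s have "s * g 1 + (1 - s) * g 0 \<le> g s" by simp
  then show ?thesis by (simp add: g_def)
qed

text \<open>The bound is the expansion of sin (t x) / sin x to second order at x = 0, with x =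
  \<theta> sqrt (K / n). It is exact at \<theta> = 0 and trivial where the coefficient is
  infinite.\<close>

lemma sigma_coeff_ge:
  fixes K n t \<theta> :: real
  assumes "K > 0" "n > 0" "0 \<le> t" "t \<le> 1" "\<theta> \<ge> 0"
  shows "ennreal (t * (1 + (1 - t\<^sup>2) * (K * \<theta>\<^sup>2 / n) / 6)) \<le> sigma_coeff K n t \<theta>"
proof (cases "K * \<theta>\<^sup>2 \<ge> n * pi\<^sup>2 \<or> \<theta> = 0")
  case True
  then show ?thesis by (auto simp: sigma_coeff_def)
next
  case False
  define x where "x = \<theta> * sqrt (K / n)"
  have x2: "x\<^sup>2 = K * \<theta>\<^sup>2 / n" using assms by (simp add: x_def power_mult_distrib)
  have x0: "x > 0" using False assms by (simp add: x_def)
  have "x\<^sup>2 < pi\<^sup>2" using False assms by (simp add: x2 divide_simps mult.commute)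
  then have xpi: "x < pi" by (rule power2_less_imp_less) simp
  have sx: "sin x > 0" using x0 xpi by (rule sin_gt_zero)
  have "t * (1 + (1 - t\<^sup>2) * x\<^sup>2 / 6) * sin x \<le> sin (t * x)"
    using assms x0 xpi by (intro sin_scaled_ge_quadratic) auto
  then have "t * (1 + (1 - t\<^sup>2) * x\<^sup>2 / 6) \<le> sin (t * x) / sin x"
    using sx by (simp add: pos_le_divide_eq)
  then show ?thesis using False unfolding x2
    by (auto simp: sigma_coeff_def x_def mult.assoc intro!: ennreal_leI)
qed

lemma sigma_coeff_ge_linear:
  fixes K n t \<theta> :: real
  assumes "K > 0" "n > 0" "0 \<le> t" "t \<le> 1" "\<theta> \<ge> 0"
  shows "ennreal t \<le> sigma_coeff K n t \<theta>"
proof -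
  have "t\<^sup>2 \<le> 1" using assms by (simp add: power_le_one)
  then have "0 \<le> (1 - t\<^sup>2) * (K * \<theta>\<^sup>2 / n) / 6" using assms by simp
  then have "t * 1 \<le> t * (1 + (1 - t\<^sup>2) * (K * \<theta>\<^sup>2 / n) / 6)"
    using assms by (intro mult_left_mono) auto
  then show ?thesis using sigma_coeff_ge[OF assms] by (auto intro: order.trans ennreal_leI)
qed

section \<open>Diameter bound and finiteness of the reference measure\<close>

locale cd_space =
  fixes m :: "'a::polish_space measure" and K N :: real
  assumes mms: "metric_measure_space m" and K_pos: "K > 0" and N_ge: "N \<ge> 1"
    and CD: "CD_star K N m"
begin

lemma sets_m [measurable_cong]: "sets m = sets borel"
  using mms by (simp add: metric_measure_space_def)

lemma space_m [simp]: "space m = UNIV"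
  using sets_eq_imp_space_eq[OF sets_m] by simp

sublocale sigma_finite_measure m
  by (rule sigma_finite_metric_measure_space[OF mms])

text \<open>Passing from \<open>RN_deriv\<close> to a real density loses nothing: a sigma-finite
  measure has an almost everywhere finite derivative.\<close>

lemma Pinf_density_dens:
  assumes "\<nu> \<in> Pinf m"
  shows "density m (\<lambda>x. ennreal (dens m \<nu> x)) = \<nu>"
proof -
  have ac: "absolutely_continuous m \<nu>" and p: "prob_space \<nu>" and s: "sets \<nu> = sets borel"
    using assms by (auto simp: Pinf_def P2_def)
  have "sigma_finite_measure \<nu>"
    using p by (rule prob_space_imp_sigma_finite)
  then have "AE x in m. RN_deriv m \<nu> x \<noteq> \<infinity>"
    by (rule RN_deriv_finite) (use s ac sets_m in auto)
  then have "AE x in m. ennreal (dens m \<nu> x) = RN_deriv m \<nu> x"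
    by eventually_elim (simp add: dens_def less_top)
  then have "density m (\<lambda>x. ennreal (dens m \<nu> x)) = density m (RN_deriv m \<nu>)"
    by (intro density_cong) (auto simp: dens_def)
  also have "\<dots> = \<nu>" using ac s sets_m by (intro density_RN_deriv) auto
  finally show ?thesis .
qed

text \<open>That the infimum is attained is read off from the curvature condition, which provides an
  optimal coupling for every pair in \<open>Pinf m\<close>; no compactness argument enters.\<close>

lemma optimal_coupling_wasserstein:
  assumes "\<nu> \<in> Pinf m" "\<nu>' \<in> Pinf m"
  obtains q where "q \<in> couplings \<nu> \<nu>'" "transport_cost q = (wasserstein \<nu> \<nu>')\<^sup>2"
    "\<forall>q'\<in>couplings \<nu> \<nu>'. (wasserstein \<nu> \<nu>')\<^sup>2 \<le> transport_cost q'"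
proof -
  obtain q where q: "q \<in> optimal_couplings \<nu> \<nu>'" using CD assms unfolding CD_star_def by blast
  have nn: "transport_cost q \<ge> 0" by (simp add: transport_cost_def)
  have "wasserstein \<nu> \<nu>' = sqrt (transport_cost q)"
    unfolding wasserstein_def using q
    by (intro cInf_eq_minimum) (auto simp: optimal_couplings_def)
  then have "(wasserstein \<nu> \<nu>')\<^sup>2 = transport_cost q" using nn by simp
  with that q show ?thesis by (auto simp: optimal_couplings_def)
qed

lemma density_in_Pinf:
  fixes h :: "'a \<Rightarrow> real"
  assumes h[measurable]: "h \<in> borel_measurable borel" and i: "(\<integral>\<^sup>+x. ennreal (h x) \<partial>m) = 1"
    and R: "AE x in m. h x > 0 \<longrightarrow> dist x0 x < R"
  shows "density m (\<lambda>x. ennreal (h x)) \<in> Pinf m"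
proof (rule PinfI_AE_bounded)
  show "absolutely_continuous m (density m (\<lambda>x. ennreal (h x)))"
    by (rule absolutely_continuousI_density) measurable
  show "prob_space (density m (\<lambda>x. ennreal (h x)))"
  proof
    have "emeasure (density m (\<lambda>x. ennreal (h x))) (space m) = (\<integral>\<^sup>+x. ennreal (h x) \<partial>m)"
      by (subst emeasure_density) (auto simp: measurable_cong_sets[OF sets_m refl])
    then show "emeasure (density m (\<lambda>x. ennreal (h x))) (space (density m (\<lambda>x. ennreal (h x)))) = 1"
      using i by simp
  qed
  show "sets (density m (\<lambda>x. ennreal (h x))) = sets borel" by (simp add: sets_m)
  show "AE x in density m (\<lambda>x. ennreal (h x)). dist x0 x < R"
    using R by (subst AE_density) auto
qed

text \<open>The working form of the condition: Radon-Nikodym derivatives are replaced by given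
  representatives, which agree almost everywhere under the marginals of q, and the sign is removed
  so that both sides are \<open>ennreal\<close> integrals.\<close>

lemma CD_densities:
  fixes h0 h1 :: "'a \<Rightarrow> real"
  assumes h0[measurable]: "h0 \<in> borel_measurable borel" and h1[measurable]: "h1 \<in> borel_measurable borel"
    and nn: "\<And>x. h0 x \<ge> 0" "\<And>x. h1 x \<ge> 0"
    and P: "density m (\<lambda>x. ennreal (h0 x)) \<in> Pinf m" "density m (\<lambda>x. ennreal (h1 x)) \<in> Pinf m"
  obtains q \<Gamma> where
    "q \<in> optimal_couplings (density m (\<lambda>x. ennreal (h0 x))) (density m (\<lambda>x. ennreal (h1 x)))"
    "geodesic_in_Pinf m \<Gamma>" "\<Gamma> 0 = density m (\<lambda>x. ennreal (h0 x))" "\<Gamma> 1 = density m (\<lambda>x. ennreal (h1 x))"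
    "\<forall>t\<in>{0..1}. \<forall>n\<ge>N.
      (\<integral>\<^sup>+z. (sigma_coeff K n (1 - t) (dist (fst z) (snd z)) * ennreal (h0 (fst z) powr (- 1 / n)) +
              sigma_coeff K n t (dist (fst z) (snd z)) * ennreal (h1 (snd z) powr (- 1 / n))) \<partial>q)
       \<le> (\<integral>\<^sup>+x. ennreal (dens m (\<Gamma> t) x powr (1 - 1 / n)) \<partial>m)"
proof -
  let ?\<nu>0 = "density m (\<lambda>x. ennreal (h0 x))" and ?\<nu>1 = "density m (\<lambda>x. ennreal (h1 x))"
  obtain q \<Gamma> where q: "q \<in> optimal_couplings ?\<nu>0 ?\<nu>1"
    and \<Gamma>: "geodesic_in_Pinf m \<Gamma>" "\<Gamma> 0 = ?\<nu>0" "\<Gamma> 1 = ?\<nu>1"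
    and ineq: "\<And>t n. t \<in> {0..1} \<Longrightarrow> n \<ge> N \<Longrightarrow> renyi_entropy n (\<Gamma> t) m \<le>
             - enn2ereal (\<integral>\<^sup>+(x0, x1).
                  (sigma_coeff K n (1 - t) (dist x0 x1) * ennreal (dens m ?\<nu>0 x0 powr (- 1 / n)) +
                   sigma_coeff K n t (dist x0 x1) * ennreal (dens m ?\<nu>1 x1 powr (- 1 / n))) \<partial>q)"
    using CD P unfolding CD_star_def by blast
  have qc: "q \<in> couplings ?\<nu>0 ?\<nu>1" using q by (simp add: optimal_couplings_def)
  have a0: "AE x in ?\<nu>0. dens m ?\<nu>0 x = h0 x"
    using dens_density_AE[OF sigma_finite_measure_axioms, of h0] nn
    by (subst AE_density) (auto simp: measurable_cong_sets[OF sets_m refl])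
  have a1: "AE x in ?\<nu>1. dens m ?\<nu>1 x = h1 x"
    using dens_density_AE[OF sigma_finite_measure_axioms, of h1] nn
    by (subst AE_density) (auto simp: measurable_cong_sets[OF sets_m refl])
  show ?thesis
  proof (rule that[OF q \<Gamma>], intro ballI allI impI)
    fix t n :: real assume tn: "t \<in> {0..1}" "n \<ge> N"
    let ?I = "\<lambda>a b. (\<integral>\<^sup>+z. (sigma_coeff K n (1 - t) (dist (fst z) (snd z)) * ennreal (a (fst z) powr (- 1 / n)) +
              sigma_coeff K n t (dist (fst z) (snd z)) * ennreal (b (snd z) powr (- 1 / n))) \<partial>q)"
    have "?I h0 h1 = ?I (dens m ?\<nu>0) (dens m ?\<nu>1)"
      by (rule nn_integral_cong_AE)
        (use AE_coupling_fst[OF qc a0] AE_coupling_snd[OF qc a1] in eventually_elim, simp)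
    also have "\<dots> \<le> (\<integral>\<^sup>+x. ennreal (dens m (\<Gamma> t) x powr (1 - 1 / n)) \<partial>m)"
      using ineq[OF tn] unfolding renyi_entropy_def
      by (simp add: case_prod_beta' less_eq_ennreal.rep_eq)
    finally show "?I h0 h1 \<le> (\<integral>\<^sup>+x. ennreal (dens m (\<Gamma> t) x powr (1 - 1 / n)) \<partial>m)" .
  qed
qed

lemma geodesic_wasserstein:
  assumes "geodesic_in_Pinf m \<Gamma>" "\<Gamma> 0 = \<nu>0" "\<Gamma> 1 = \<nu>1" "0 \<le> t" "t \<le> 1"
  shows "wasserstein \<nu>0 (\<Gamma> t) = t * wasserstein \<nu>0 \<nu>1"
    "wasserstein (\<Gamma> t) \<nu>1 = (1 - t) * wasserstein \<nu>0 \<nu>1"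
proof -
  have *: "wasserstein (\<Gamma> s) (\<Gamma> u) = \<bar>s - u\<bar> * wasserstein (\<Gamma> 0) (\<Gamma> 1)"
    if "s \<in> {0..1}" "u \<in> {0..1}" for s u
    using assms(1) that unfolding geodesic_in_Pinf_def by blast
  show "wasserstein \<nu>0 (\<Gamma> t) = t * wasserstein \<nu>0 \<nu>1"
    using *[of 0 t] assms by simp
  show "wasserstein (\<Gamma> t) \<nu>1 = (1 - t) * wasserstein \<nu>0 \<nu>1"
    using *[of t 1] assms by simp
qed

section \<open>Uniform distributions on sets of finite positive measure\<close>

lemma emeasure_measure_pos:
  assumes "0 < emeasure M B" "emeasure M B < \<infinity>"
  shows "emeasure M B = ennreal (measure M B)" "0 < measure M B"
proof -
  show *: "emeasure M B = ennreal (measure M B)"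
    using assms by (intro emeasure_eq_ennreal_measure) (simp add: less_top)
  show "0 < measure M B" using assms(1) unfolding * by simp
qed

definition unif :: "'a set \<Rightarrow> 'a \<Rightarrow> real" where
  "unif B x = indicator B x / measure m B"

lemma unif_nonneg: "unif B x \<ge> 0"
  by (simp add: unif_def)

lemma unif_measurable: "B \<in> sets borel \<Longrightarrow> unif B \<in> borel_measurable borel"
  unfolding unif_def by (intro borel_measurable_divide borel_measurable_indicator borel_measurable_const)

lemma nn_integral_unif:
  assumes "B \<in> sets borel" "0 < emeasure m B" "emeasure m B < \<infinity>"
  shows "(\<integral>\<^sup>+x. ennreal (unif B x) \<partial>m) = 1"
proof -
  have mB: "emeasure m B = ennreal (measure m B)" "measure m B > 0"
    using emeasure_measure_pos[OF assms(2,3)] by auto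
  have "(\<integral>\<^sup>+x. ennreal (unif B x) \<partial>m) = (\<integral>\<^sup>+x. ennreal (1 / measure m B) * indicator B x \<partial>m)"
    by (intro nn_integral_cong) (auto simp: unif_def indicator_def)
  also have "\<dots> = ennreal (1 / measure m B) * emeasure m B"
    using assms by (intro nn_integral_cmult_indicator) (simp add: sets_m)
  also have "\<dots> = 1" using mB by (simp add: ennreal_mult[symmetric])
  finally show ?thesis .
qed

lemma unif_in_Pinf:
  assumes "B \<in> sets borel" "0 < emeasure m B" "emeasure m B < \<infinity>"
    and "AE x in m. x \<in> B \<longrightarrow> dist x0 x < R"
  shows "density m (\<lambda>x. ennreal (unif B x)) \<in> Pinf m"
proof (rule density_in_Pinf)
  show "AE x in m. unif B x > 0 \<longrightarrow> dist x0 x < R"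
    using assms(4) by eventually_elim (auto simp: unif_def indicator_def split: if_splits)
qed (use assms unif_measurable nn_integral_unif in auto)

lemma AE_unif:
  assumes "B \<in> sets borel"
  shows "AE x in density m (\<lambda>x. ennreal (unif B x)). x \<in> B"
proof -
  have [measurable]: "unif B \<in> borel_measurable borel" by (rule unif_measurable[OF assms])
  have "(\<lambda>x. ennreal (unif B x)) \<in> borel_measurable m" by measurable
  moreover have "AE x in m. 0 < ennreal (unif B x) \<longrightarrow> x \<in> B"
    by (rule AE_I2) (simp add: unif_def indicator_def)
  ultimately show ?thesis by (simp add: AE_density)
qed

lemma small_ball:
  assumes "d > 0"
  obtains r where "0 < r" "r \<le> d" "emeasure m (ball x r) < \<infinity>"
proof -
  obtain r where r: "r > 0" "emeasure m (ball x r) < \<infinity>"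
    using mms by (auto simp: metric_measure_space_def)
  have "emeasure m (ball x (min r d)) \<le> emeasure m (ball x r)"
    by (intro emeasure_mono) (auto simp: sets_m)
  then have "emeasure m (ball x (min r d)) < \<infinity>" using r(2) by (rule order.strict_trans1)
  with that[of "min r d"] r assms show ?thesis by auto
qed

text \<open>
  At time \<open>0\<close> the curvature condition bounds the entropy of the initial measure by an integral
  whose integrand is infinite as soon as \<open>K d\<^sup>2 \<ge> N \<pi>\<^sup>2\<close>.
\<close>

lemma bonnet_myers:
  assumes x: "x \<in> measure_support m" and y: "y \<in> measure_support m"
  shows "dist x y \<le> pi * sqrt (N / K)"
proof (rule ccontr)
  assume far: "\<not> dist x y \<le> pi * sqrt (N / K)"
  \<comment> \<open>Half of the excess: points in balls of radius at most d around x and y are still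
    at least the critical distance apart.\<close>
  define d where "d = (dist x y - pi * sqrt (N / K)) / 2"
  have d: "d > 0" using far by (simp add: d_def)
  obtain r where r: "0 < r" "r \<le> d" "emeasure m (ball x r) < \<infinity>" using small_ball[OF d] .
  obtain s where s: "0 < s" "s \<le> d" "emeasure m (ball y s) < \<infinity>" using small_ball[OF d] .
  let ?A = "ball x r" and ?B = "ball y s"
  have A: "?A \<in> sets borel" "0 < emeasure m ?A" using x r by (auto simp: measure_support_def)
  have B: "?B \<in> sets borel" "0 < emeasure m ?B" using y s by (auto simp: measure_support_def)
  have mA: "measure m ?A > 0" using emeasure_measure_pos[OF A(2) r(3)] by simp
  let ?\<nu>0 = "density m (\<lambda>x. ennreal (unif ?A x))" and ?\<nu>1 = "density m (\<lambda>x. ennreal (unif ?B x))"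
  have P: "?\<nu>0 \<in> Pinf m" "?\<nu>1 \<in> Pinf m"
    using unif_in_Pinf[OF A r(3), of x r] unif_in_Pinf[OF B s(3), of y s] by auto
  obtain q \<Gamma> where q: "q \<in> optimal_couplings ?\<nu>0 ?\<nu>1"
    and "geodesic_in_Pinf m \<Gamma>" and \<Gamma>0: "\<Gamma> 0 = ?\<nu>0" and "\<Gamma> 1 = ?\<nu>1"
    and ineq: "\<forall>t\<in>{0..1}. \<forall>n\<ge>N.
      (\<integral>\<^sup>+z. (sigma_coeff K n (1 - t) (dist (fst z) (snd z)) * ennreal (unif ?A (fst z) powr (- 1 / n)) +
              sigma_coeff K n t (dist (fst z) (snd z)) * ennreal (unif ?B (snd z) powr (- 1 / n))) \<partial>q)
       \<le> (\<integral>\<^sup>+x. ennreal (dens m (\<Gamma> t) x powr (1 - 1 / n)) \<partial>m)"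
    by (rule CD_densities[OF unif_measurable[OF A(1)] unif_measurable[OF B(1)] unif_nonneg unif_nonneg P])
      (rule that; assumption)
  have qc: "q \<in> couplings ?\<nu>0 ?\<nu>1" using q by (simp add: optimal_couplings_def)
  then interpret q: prob_space q by (simp add: couplings_def)
  have [measurable]: "unif ?A \<in> borel_measurable borel" by (rule unif_measurable[OF A(1)])
  have um: "unif ?A \<in> borel_measurable m" by measurable
  have "AE z in q. \<infinity> \<le>
      sigma_coeff K N (1 - 0) (dist (fst z) (snd z)) * ennreal (unif ?A (fst z) powr (- 1 / N)) +
      sigma_coeff K N 0 (dist (fst z) (snd z)) * ennreal (unif ?B (snd z) powr (- 1 / N))"
    using AE_coupling_fst[OF qc AE_unif[OF A(1)]] AE_coupling_snd[OF qc AE_unif[OF B(1)]]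
  proof eventually_elim
    case (elim z)
    have "dist x y \<le> dist x (fst z) + dist (fst z) (snd z) + dist y (snd z)"
      by (smt (verit) dist_commute dist_triangle)
    then have "pi * sqrt (N / K) \<le> dist (fst z) (snd z)"
      using elim r s by (simp add: d_def field_simps)
    then have "(pi * sqrt (N / K))\<^sup>2 \<le> (dist (fst z) (snd z))\<^sup>2"
      using N_ge K_pos by (intro power_mono) auto
    then have "N * pi\<^sup>2 \<le> K * (dist (fst z) (snd z))\<^sup>2"
      using N_ge K_pos by (simp add: power_mult_distrib field_simps)
    then have "sigma_coeff K N (1 - 0) (dist (fst z) (snd z)) = \<infinity>" by (simp add: sigma_coeff_def)
    \<comment> \<open>Positivity matters because infinity times 0 is 0 in
      \<open>ennreal\<close>.\<close>
    moreover have "unif ?A (fst z) powr (- 1 / N) > 0" using elim mA by (simp add: unif_def)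
    ultimately show ?case by (simp add: ennreal_top_mult)
  qed
  then have "(\<integral>\<^sup>+z. \<infinity> \<partial>q) \<le> (\<integral>\<^sup>+x. ennreal (dens m (\<Gamma> 0) x powr (1 - 1 / N)) \<partial>m)"
    by (rule order.trans[OF nn_integral_mono_AE]) (rule ineq[rule_format], auto)
  also have "\<dots> = (\<integral>\<^sup>+x. ennreal ((1 / measure m ?A) powr (1 - 1 / N)) * indicator ?A x \<partial>m)"
    unfolding \<Gamma>0
  proof (rule nn_integral_cong_AE)
    show "AE x in m. ennreal (dens m ?\<nu>0 x powr (1 - 1 / N))
        = ennreal ((1 / measure m ?A) powr (1 - 1 / N)) * indicator ?A x"
      using dens_density_AE[OF sigma_finite_measure_axioms um unif_nonneg]
    proof eventually_elim
      case (elim x)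
      then show ?case by (cases "x \<in> ?A") (auto simp: unif_def)
    qed
  qed
  also have "\<dots> = ennreal ((1 / measure m ?A) powr (1 - 1 / N)) * emeasure m ?A"
    by (rule nn_integral_cmult_indicator) (simp add: sets_m)
  also have "\<dots> < \<infinity>" using r(3) by (simp add: ennreal_mult_less_top)
  finally show False by (simp add: q.emeasure_space_1)
qed

lemma support_nonempty:
  assumes "emeasure m UNIV \<noteq> 0"
  shows "\<exists>x. x \<in> measure_support m"
proof (rule ccontr)
  assume "\<nexists>x. x \<in> measure_support m"
  then have "AE x in m. False" using AE_in_measure_support[OF sets_m] by simp
  then show False using assms AE_iff_measurable[of UNIV m "\<lambda>_. False"] by (simp add: sets_m)
qed

lemma AE_dist_less:
  assumes "x0 \<in> measure_support m"
  shows "AE x in m. dist x0 x < pi * sqrt (N / K) + 1"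
  using AE_in_measure_support[OF sets_m]
proof eventually_elim
  case (elim x)
  then have "dist x0 x \<le> pi * sqrt (N / K)" by (rule bonnet_myers[OF assms])
  then show ?case by simp
qed

lemma powr_le_one_plus:
  fixes u a :: real
  assumes "u \<ge> 0" "0 \<le> a" "a \<le> 1"
  shows "u powr a \<le> 1 + u"
proof (cases "u \<le> 1")
  case True
  then have "u powr a \<le> 1" using assms powr_le1 by auto
  then show ?thesis using assms by simp
next
  case False
  then have "u powr a \<le> u powr 1" using assms by (intro powr_mono) auto
  then show ?thesis using False by simp
qed

text \<open>
  For small \<open>t\<close> the geodesic from the uniform measure on a small ball to the uniform measure on an
  arbitrary set \<open>B\<close> is still inside a fixed ball of finite measure, which bounds the measure of \<open>B\<close>.
\<close>

lemma finite_measure_m: "finite_measure m"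
proof (cases "emeasure m UNIV = 0")
  case True
  then show ?thesis by (intro finite_measureI) simp
next
  case False
  define D where "D = pi * sqrt (N / K)"
  have D0: "D \<ge> 0" using K_pos N_ge by (simp add: D_def)
  note supp = AE_in_measure_support[OF sets_m]
  obtain x0 where x0: "x0 \<in> measure_support m" using support_nonempty[OF False] by blast
  obtain r where r: "0 < r" "r \<le> 1" "emeasure m (ball x0 r) < \<infinity>" using small_ball[of 1 x0] by auto
  \<comment> \<open>Chosen so that mass starting in the ball of radius r / 2 and moving by at most t
    D stays in the ball of radius r. The cap 1/2 is what the displacement bound requires.\<close>
  define t where "t = min (1/2) (r / (2 * (D + 1)))"
  have t: "0 < t" "t \<le> 1/2" using r D0 by (auto simp: t_def)
  have "t * D \<le> r / (2 * (D + 1)) * D" using D0 by (intro mult_right_mono) (auto simp: t_def)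
  also have "\<dots> \<le> r / 2" using D0 r by (simp add: field_simps)
  finally have tD: "t * D \<le> r / 2" .
  let ?A = "ball x0 (r / 2)"
  have A: "?A \<in> sets borel" "0 < emeasure m ?A" using x0 r by (auto simp: measure_support_def)
  have "emeasure m ?A \<le> emeasure m (ball x0 r)" using r by (intro emeasure_mono) (auto simp: sets_m)
  then have A3: "emeasure m ?A < \<infinity>" using r(3) by (rule order.strict_trans1)
  \<comment> \<open>Bounds the entropy integral at time t through
    \<open>u powr (1 - 1 / N) \<le> 1 + u\<close>: the 1 integrates to the measure of the ball
    carrying \<open>\<Gamma> t\<close>, the u to the total mass 1.\<close>
  define C where "C = measure m (ball x0 r) + 1"
  have bound: "emeasure m B \<le> ennreal ((C / t) powr N)"
    if B: "B \<in> sets borel" "emeasure m B < \<infinity>" for B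
  proof (cases "emeasure m B = 0")
    case nz: False
    then have B2: "0 < emeasure m B" by (simp add: zero_less_iff_neq_zero)
    have mB: "emeasure m B = ennreal (measure m B)" "measure m B > 0"
      using emeasure_measure_pos[OF B2 B(2)] by auto
    let ?\<nu>0 = "density m (\<lambda>x. ennreal (unif ?A x))" and ?\<nu>1 = "density m (\<lambda>x. ennreal (unif B x))"
    have bd: "AE x in m. dist x0 x < D + 1" unfolding D_def by (rule AE_dist_less[OF x0])
    have P0: "?\<nu>0 \<in> Pinf m" by (rule unif_in_Pinf[OF A A3, of x0 "r/2"]) auto
    have P1: "?\<nu>1 \<in> Pinf m"
      by (rule unif_in_Pinf[OF B(1) B2 B(2), of x0 "D + 1"]) (use bd in auto)
    obtain q \<Gamma> where q: "q \<in> optimal_couplings ?\<nu>0 ?\<nu>1"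
      and \<Gamma>: "geodesic_in_Pinf m \<Gamma>" "\<Gamma> 0 = ?\<nu>0" "\<Gamma> 1 = ?\<nu>1"
      and ineq: "\<forall>t\<in>{0..1}. \<forall>n\<ge>N.
        (\<integral>\<^sup>+z. (sigma_coeff K n (1 - t) (dist (fst z) (snd z)) * ennreal (unif ?A (fst z) powr (- 1 / n)) +
                sigma_coeff K n t (dist (fst z) (snd z)) * ennreal (unif B (snd z) powr (- 1 / n))) \<partial>q)
         \<le> (\<integral>\<^sup>+x. ennreal (dens m (\<Gamma> t) x powr (1 - 1 / n)) \<partial>m)"
      by (rule CD_densities[OF unif_measurable[OF A(1)] unif_measurable[OF B(1)] unif_nonneg unif_nonneg P0 P1])
        (rule that; assumption)
    have qc: "q \<in> couplings ?\<nu>0 ?\<nu>1" using q by (simp add: optimal_couplings_def)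
    then interpret q: prob_space q by (simp add: couplings_def)
    define W where "W = wasserstein ?\<nu>0 ?\<nu>1"
    have Pt: "\<Gamma> t \<in> Pinf m" using \<Gamma> t by (simp add: geodesic_in_Pinf_def)
    have W0: "wasserstein ?\<nu>0 (\<Gamma> t) = t * W" and W1: "wasserstein (\<Gamma> t) ?\<nu>1 = (1 - t) * W"
      using geodesic_wasserstein[OF \<Gamma>, of t] t by (simp_all add: W_def)
    obtain q1 where q1: "q1 \<in> couplings ?\<nu>0 (\<Gamma> t)" "transport_cost q1 = (t * W)\<^sup>2"
      using optimal_coupling_wasserstein[OF P0 Pt] W0 by metis
    obtain q2 where q2: "q2 \<in> couplings (\<Gamma> t) ?\<nu>1" "transport_cost q2 = ((1 - t) * W)\<^sup>2"
      using optimal_coupling_wasserstein[OF Pt P1] W1 by metis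
    have opt: "W\<^sup>2 \<le> transport_cost q'" if "q' \<in> couplings ?\<nu>0 ?\<nu>1" for q'
      using optimal_coupling_wasserstein[OF P0 P1] that unfolding W_def by metis
    have ac: "AE x in \<nu>. x \<in> measure_support m" if "\<nu> \<in> Pinf m" for \<nu>
      using that supp sets_m
      by (intro absolutely_continuous_AE[of \<nu> m]) (auto simp: Pinf_def P2_def)
    have "AE z in q1. dist (fst z) (snd z) \<le> t * D"
      by (rule dist_le_of_interpolation[OF q1(1) q2(1) t ac[OF P0] ac[OF Pt] ac[OF P1] _ D0 q1(2) q2(2) opt])
        (use bonnet_myers in \<open>auto simp: D_def\<close>)
    with AE_coupling_fst[OF q1(1) AE_unif[OF A(1)]]
    have "AE z in q1. snd z \<in> ball x0 r"
    proof eventually_elim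
      case (elim z)
      have "dist x0 (snd z) \<le> dist x0 (fst z) + dist (fst z) (snd z)" by (rule dist_triangle)
      then show ?case using elim tD by simp
    qed
    moreover have "snd \<in> q1 \<rightarrow>\<^sub>M borel" "distr q1 borel snd = \<Gamma> t"
      using q1(1) unfolding couplings_def by (auto cong: measurable_cong_sets)
    ultimately have "AE y in distr q1 borel snd. y \<in> ball x0 r" by (subst AE_distr_iff) auto
    with \<open>distr q1 borel snd = \<Gamma> t\<close> have loc: "AE y in \<Gamma> t. y \<in> ball x0 r" by metis
    have dm[measurable]: "dens m (\<Gamma> t) \<in> borel_measurable m" unfolding dens_def by measurable
    have dt: "AE x in m. dens m (\<Gamma> t) x > 0 \<longrightarrow> x \<in> ball x0 r"
    proof -
      have "AE y in density m (\<lambda>x. ennreal (dens m (\<Gamma> t) x)). y \<in> ball x0 r"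
        using loc unfolding Pinf_density_dens[OF Pt] .
      then show ?thesis by (subst (asm) AE_density) auto
    qed
    have dnn: "dens m (\<Gamma> t) x \<ge> 0" for x by (simp add: dens_def)
    have "(\<integral>\<^sup>+x. ennreal (dens m (\<Gamma> t) x) \<partial>m)
        = emeasure (density m (\<lambda>x. ennreal (dens m (\<Gamma> t) x))) UNIV"
      by (subst emeasure_density) (auto simp: sets_m)
    also have "\<dots> = emeasure (\<Gamma> t) UNIV" unfolding Pinf_density_dens[OF Pt] ..
    also have "\<dots> = 1"
    proof -
      have "prob_space (\<Gamma> t)" "space (\<Gamma> t) = UNIV"
        using Pt sets_eq_imp_space_eq[of "\<Gamma> t" borel] by (auto simp: Pinf_def P2_def)
      then show ?thesis using prob_space.emeasure_space_1 by fastforce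
    qed
    finally have mass: "(\<integral>\<^sup>+x. ennreal (dens m (\<Gamma> t) x) \<partial>m) = 1" .
    have "ennreal (t * measure m B powr (1 / N)) = (\<integral>\<^sup>+z. ennreal (t * measure m B powr (1 / N)) \<partial>q)"
      by (simp add: q.emeasure_space_1)
    also have "\<dots> \<le> (\<integral>\<^sup>+z. (sigma_coeff K N (1 - t) (dist (fst z) (snd z)) * ennreal (unif ?A (fst z) powr (- 1 / N)) +
                sigma_coeff K N t (dist (fst z) (snd z)) * ennreal (unif B (snd z) powr (- 1 / N))) \<partial>q)"
    \<comment> \<open>Only the term of the terminal measure is kept; on B its density power is the
      constant \<open>measure m B powr (1 / N)\<close>.\<close>
    proof (rule nn_integral_mono_AE)
      show "AE z in q. ennreal (t * measure m B powr (1 / N)) \<le>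
        sigma_coeff K N (1 - t) (dist (fst z) (snd z)) * ennreal (unif ?A (fst z) powr (- 1 / N)) +
        sigma_coeff K N t (dist (fst z) (snd z)) * ennreal (unif B (snd z) powr (- 1 / N))"
        using AE_coupling_snd[OF qc AE_unif[OF B(1)]]
      proof eventually_elim
        case (elim z)
        have u: "unif B (snd z) powr (- 1 / N) = measure m B powr (1 / N)"
          using elim mB by (simp add: unif_def powr_divide powr_minus_divide)
        have "ennreal (t * measure m B powr (1 / N)) = ennreal t * ennreal (measure m B powr (1 / N))"
          using t by (simp add: ennreal_mult)
        also have "\<dots> \<le> sigma_coeff K N t (dist (fst z) (snd z)) * ennreal (unif B (snd z) powr (- 1 / N))"
          unfolding u using t K_pos N_ge by (intro mult_right_mono sigma_coeff_ge_linear) auto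
        finally show ?case by (simp add: add_increasing)
      qed
    qed
    also have "\<dots> \<le> (\<integral>\<^sup>+x. ennreal (dens m (\<Gamma> t) x powr (1 - 1 / N)) \<partial>m)"
      using t by (intro ineq[rule_format]) auto
    also have "\<dots> \<le> (\<integral>\<^sup>+x. (indicator (ball x0 r) x + ennreal (dens m (\<Gamma> t) x)) \<partial>m)"
    proof (rule nn_integral_mono_AE)
      show "AE x in m. ennreal (dens m (\<Gamma> t) x powr (1 - 1 / N))
          \<le> indicator (ball x0 r) x + ennreal (dens m (\<Gamma> t) x)"
        using dt
      proof eventually_elim
        case (elim x)
        show ?case
        proof (cases "dens m (\<Gamma> t) x > 0")
          case True
          have "dens m (\<Gamma> t) x powr (1 - 1 / N) \<le> 1 + dens m (\<Gamma> t) x"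
            using dnn N_ge by (intro powr_le_one_plus) auto
          then have "ennreal (dens m (\<Gamma> t) x powr (1 - 1 / N)) \<le> ennreal (1 + dens m (\<Gamma> t) x)"
            by (rule ennreal_leI)
          then show ?thesis using True elim dnn by (simp add: ennreal_plus)
        next
          case False
          then have "dens m (\<Gamma> t) x = 0" using dnn[of x] by simp
          \<comment> \<open>Also for N = 1, where the exponent is 0, the left side vanishes because
            \<open>0 powr 0 = 0\<close>.\<close>
          then show ?thesis by simp
        qed
      qed
    qed
    also have "\<dots> = emeasure m (ball x0 r) + 1"
      by (subst nn_integral_add) (auto simp: mass sets_m intro!: borel_measurable_indicator)
    also have "\<dots> = ennreal C"
      using r(3) by (simp add: C_def emeasure_eq_ennreal_measure less_top ennreal_plus)
    finally have "t * measure m B powr (1 / N) \<le> C"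
      by (subst (asm) ennreal_le_iff) (auto simp: C_def)
    then have "measure m B powr (1 / N) \<le> C / t" using t by (simp add: field_simps)
    then have "(measure m B powr (1 / N)) powr N \<le> (C / t) powr N"
      using N_ge by (intro powr_mono2) auto
    then have "measure m B \<le> (C / t) powr N" using N_ge mB by (simp add: powr_powr)
    then show ?thesis using mB by (simp add: ennreal_leI)
  qed simp
  \<comment> \<open>The bound does not depend on B, so it survives an exhaustion by sets of finite
    measure.\<close>
  obtain A' :: "nat \<Rightarrow> 'a set" where A': "range A' \<subseteq> sets m" "(\<Union>i. A' i) = space m"
    "\<And>i. emeasure m (A' i) \<noteq> \<infinity>" "incseq A'"
    using sigma_finite_incseq by metis
  have "emeasure m (space m) = (SUP i. emeasure m (A' i))"
    using SUP_emeasure_incseq[OF A'(1,4)] A'(2) by simp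
  also have "\<dots> \<le> ennreal ((C / t) powr N)"
    using A' by (intro SUP_least bound) (auto simp: sets_m less_top)
  finally show ?thesis by (intro finite_measureI) (auto simp: top_unique)
qed

section \<open>First variation along the geodesic to the uniform measure\<close>

text \<open>
  The Renyi entropy is compared along the geodesic from \<open>h m / V\<close>, with \<open>h = 1 + e f\<close>, to \<open>m / V\<close>.
  At time \<open>t\<close> the concave function \<open>u powr (1 - 1 / n)\<close> is replaced by its tangent at the initial
  density; what remains is the change of the integral of \<open>h powr (- 1 / n)\<close>, controlled by the slope of \<open>f\<close>.
  The parameter \<open>l\<close> is the weight in Young's inequality, chosen later so that the terms with \<open>W\<^sup>2\<close> cancel.
\<close>

lemma entropy_variation:
  fixes f :: "'a \<Rightarrow> real"
  assumes lip: "L-lipschitz_on UNIV f" and F: "\<And>x. \<bar>f x\<bar> \<le> F"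
    and int0: "(\<integral>x. f x \<partial>m) = 0" and mpos: "emeasure m UNIV > 0"
    and e: "e > 0" "e * F \<le> 1 / 2" and t: "0 < t" "t \<le> 1 / 2"
    and n: "n \<ge> N" "n > 1" and l: "l > 0" and r: "r > 0"
  defines "V \<equiv> measure m UNIV"
  defines "\<nu> \<equiv> density m (\<lambda>x. ennreal ((1 + e * f x) / V))"
  defines "W \<equiv> wasserstein \<nu> (density m (\<lambda>x. ennreal (1 / V)))"
  defines "P \<equiv> (\<integral>x. (1 + e * f x) powr (1 - 1 / n) \<partial>m) / V"
  defines "G \<equiv> (\<integral>x. (enn2real (slope_at_scale f r x))\<^sup>2 \<partial>\<nu>)"
  shows "1 - P + K / (6 * n) * W\<^sup>2 * ((1 - t) * (2 - t) / (1 + e * F) + (1 - t\<^sup>2))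
    \<le> e / (n * (1 - e * F)\<^sup>2) * (l / 2 * G + W\<^sup>2 / (2 * l) + L * t * W\<^sup>2 / r)"
proof -
  interpret finite_measure m by (rule finite_measure_m)
  note supp = AE_in_measure_support[OF sets_m]
  define D where "D = pi * sqrt (N / K)"
  define a where "a = 1 - 1 / n"
  have a: "0 < a" "a < 1" using n by (auto simp: a_def)
  define d where "d = e * F"
  have d: "0 \<le> d" "d \<le> 1 / 2" using e F[of undefined] by (auto simp: d_def)
  have V: "V > 0" "emeasure m UNIV = ennreal V"
    using mpos by (auto simp: V_def emeasure_eq_measure)
  define h where "h x = 1 + e * f x" for x
  have ef: "\<bar>e * f x\<bar> \<le> d" for x using F[of x] e by (simp add: abs_mult d_def)
  have h: "1 - d \<le> h x" "h x \<le> 1 + d" "1 / 2 \<le> h x" "h x > 0" for x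
    using ef[of x] d by (auto simp: h_def)
  have fc: "continuous_on UNIV f" using lip by (rule lipschitz_on_continuous_on)
  have fm[measurable]: "f \<in> borel_measurable borel" using fc by (rule borel_measurable_continuous_onI)
  have hm[measurable]: "h \<in> borel_measurable borel" unfolding h_def by measurable
  define g where "g x = h x powr (- 1 / n)" for x
  have gm[measurable]: "g \<in> borel_measurable borel" unfolding g_def by measurable
  have g: "1 / (1 + d) \<le> g x" "g x \<ge> 0" for x
    using powr_minus_ge[of "h x" d "1 / n"] h[of x] d n by (auto simp: g_def)
  have gbd: "g x \<le> 2" for x
  proof -
    have "g x \<le> (1 / 2) powr (- 1 / n)" unfolding g_def using h[of x] n by (intro powr_mono2') auto
    also have "\<dots> \<le> (1 / 2) powr (- 1)" using n by (intro powr_mono') auto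
    finally show ?thesis by (simp add: powr_minus_divide)
  qed
  have hl: "h x powr (- 1 / n) * h x = h x powr a" for x
    using h[of x] powr_add[of "h x" "- 1 / n" 1] by (simp add: a_def)
  let ?\<nu>1 = "density m (\<lambda>x. ennreal (1 / V))"
  have \<nu>: "\<nu> = density m (\<lambda>x. ennreal (h x / V))" by (simp add: \<nu>_def h_def)
  obtain x0 where x0: "x0 \<in> measure_support m" using support_nonempty mpos by fastforce
  have bd: "AE x in m. dist x0 x < D + 1" unfolding D_def by (rule AE_dist_less[OF x0])
  have fi: "integrable m f"
    by (rule integrable_const_bound[of _ F]) (use F in auto)
  have hi: "integrable m h" unfolding h_def using fi by simp
  have "(\<integral>x. h x \<partial>m) = V" unfolding h_def using fi int0 by (simp add: V_def)
  then have mass0: "(\<integral>\<^sup>+x. ennreal (h x / V) \<partial>m) = 1"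
    using hi h V by (subst nn_integral_eq_integral) (auto simp: less_imp_le)
  have mass1: "(\<integral>\<^sup>+x. ennreal (1 / V) \<partial>m) = 1"
    using V by (simp add: ennreal_mult[symmetric])
  have P0: "\<nu> \<in> Pinf m" unfolding \<nu>
    by (rule density_in_Pinf[OF _ mass0, of x0 "D + 1"]) (use bd in auto)
  have P1: "?\<nu>1 \<in> Pinf m"
    by (rule density_in_Pinf[OF _ mass1, of x0 "D + 1"]) (use bd in auto)
  have hV: "(\<lambda>x. h x / V) \<in> borel_measurable borel" by measurable
  have cV: "(\<lambda>x. 1 / V) \<in> borel_measurable borel" by measurable
  have hVnn: "h x / V \<ge> 0" for x using h[of x] V by simp
  have cVnn: "1 / V \<ge> 0" using V by simp
  obtain q \<Gamma> where q: "q \<in> optimal_couplings \<nu> ?\<nu>1"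
    and \<Gamma>: "geodesic_in_Pinf m \<Gamma>" "\<Gamma> 0 = \<nu>" "\<Gamma> 1 = ?\<nu>1"
    and ineq: "\<forall>t\<in>{0..1}. \<forall>n\<ge>N.
      (\<integral>\<^sup>+z. (sigma_coeff K n (1 - t) (dist (fst z) (snd z)) * ennreal ((h (fst z) / V) powr (- 1 / n)) +
              sigma_coeff K n t (dist (fst z) (snd z)) * ennreal ((1 / V) powr (- 1 / n))) \<partial>q)
       \<le> (\<integral>\<^sup>+x. ennreal (dens m (\<Gamma> t) x powr (1 - 1 / n)) \<partial>m)"
    by (rule CD_densities[OF hV cV hVnn cVnn P0[unfolded \<nu>] P1, folded \<nu>]) (rule that; assumption)
  have qc: "q \<in> couplings \<nu> ?\<nu>1" using q by (simp add: optimal_couplings_def)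
  have [measurable_cong]: "sets q = sets (borel \<Otimes>\<^sub>M borel)" using qc by (simp add: couplings_def)
  interpret q: prob_space q using qc by (simp add: couplings_def)
  have Pt: "\<Gamma> t \<in> Pinf m" using \<Gamma> t by (simp add: geodesic_in_Pinf_def)
  have W0: "wasserstein \<nu> (\<Gamma> t) = t * W"
    using geodesic_wasserstein[OF \<Gamma>, of t] t by (simp add: W_def)
  \<comment> \<open>The coupling q joins the end points only and does not locate the mass at time t.
    The slope estimate therefore runs over this second coupling.\<close>
  obtain q1 where q1: "q1 \<in> couplings \<nu> (\<Gamma> t)" "transport_cost q1 = (t * W)\<^sup>2"
    using optimal_coupling_wasserstein[OF P0 Pt] W0 by metis
  have [measurable_cong]: "sets q1 = sets (borel \<Otimes>\<^sub>M borel)" using q1 by (simp add: couplings_def)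
  interpret q1: prob_space q1 using q1 by (simp add: couplings_def)
  have cost: "transport_cost q = W\<^sup>2"
  proof -
    obtain q' where q': "q' \<in> couplings \<nu> ?\<nu>1" "transport_cost q' = W\<^sup>2"
      "\<forall>q\<in>couplings \<nu> ?\<nu>1. W\<^sup>2 \<le> transport_cost q"
      by (rule optimal_coupling_wasserstein[OF P0 P1, folded W_def]) (rule that; assumption)
    then have "transport_cost q \<le> W\<^sup>2" using q by (auto simp: optimal_couplings_def)
    with q'(3) qc show ?thesis by (simp add: antisym)
  qed
  have ac: "AE x in \<nu>'. x \<in> measure_support m" if "\<nu>' \<in> Pinf m" for \<nu>'
    using that supp sets_m
    by (intro absolutely_continuous_AE[of \<nu>' m]) (auto simp: Pinf_def P2_def)
  have dq: "AE z in q. dist (fst z) (snd z) \<le> D"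
    using AE_coupling_fst[OF qc ac[OF P0]] AE_coupling_snd[OF qc ac[OF P1]]
    by eventually_elim (auto simp: D_def intro: bonnet_myers)
  have dq1: "AE z in q1. dist (fst z) (snd z) \<le> D"
    using AE_coupling_fst[OF q1(1) ac[OF P0]] AE_coupling_snd[OF q1(1) ac[OF Pt]]
    by eventually_elim (auto simp: D_def intro: bonnet_myers)
  have iq: "integrable q (\<lambda>z. (dist (fst z) (snd z))\<^sup>2)"
    by (rule q.integrable_const_bound[of _ "D\<^sup>2"])
      (use dq in eventually_elim, auto intro!: power_mono)
  have iq1: "integrable q1 (\<lambda>z. (dist (fst z) (snd z))\<^sup>2)"
    by (rule q1.integrable_const_bound[of _ "D\<^sup>2"])
      (use dq1 in eventually_elim, auto intro!: power_mono)
  have igq: "integrable q (\<lambda>z. g (fst z))"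
    by (rule q.integrable_const_bound[of _ 2]) (use g gbd in auto)
  have igq1: "integrable q1 (\<lambda>z. g (fst z))" "integrable q1 (\<lambda>z. g (snd z))"
    by (rule q1.integrable_const_bound[of _ 2]; use g gbd in auto)+
  have PV: "P = (\<integral>x. h x powr a \<partial>m) / V" by (simp add: P_def h_def a_def)
  have P: "P = (\<integral>x. g x \<partial>\<nu>)"
  proof -
    have "(\<integral>x. g x \<partial>\<nu>) = (\<integral>x. (h x / V) *\<^sub>R g x \<partial>m)"
      unfolding \<nu> by (rule integral_density) (auto simp: hVnn)
    also have "\<dots> = (\<integral>x. h x powr a / V \<partial>m)"
      by (intro Bochner_Integration.integral_cong) (auto simp: g_def hl[symmetric])
    finally show ?thesis by (simp add: PV)
  qed
  \<comment> \<open>P and Q integrate the same g, against the measures at times 0 and t. Up to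
    constants Q - P is the linearised change of entropy.\<close>
  define Q where "Q = (\<integral>x. g x \<partial>\<Gamma> t)"
  \<comment> \<open>Lower bound for the integrand of the curvature condition after division by
    \<open>V powr (1 / n)\<close>. It uses (1 - t) (1 - (1 - t)^2) = t (1 - t) (2 - t), and g \<ge>
    1 / (1 + d) in the quadratic part, so that there only the cost of q has to be known.\<close>
  let ?b = "\<lambda>z. (1 - t) * g (fst z) + t +
    K / (6 * n) * t * ((1 - t) * (2 - t) / (1 + d) + (1 - t\<^sup>2)) * (dist (fst z) (snd z))\<^sup>2"
  have t2: "t\<^sup>2 \<le> 1" using t by (simp add: power_le_one)
  have coef: "K / (6 * n) * t * ((1 - t) * (2 - t) / (1 + d) + (1 - t\<^sup>2)) \<ge> 0"
    using K_pos n t t2 d by (intro mult_nonneg_nonneg add_nonneg_nonneg divide_nonneg_nonneg) auto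
  have lower: "ennreal (V powr (1 / n) * (\<integral>z. ?b z \<partial>q)) \<le> (\<integral>\<^sup>+x. ennreal (dens m (\<Gamma> t) x powr a) \<partial>m)"
  proof -
    have ib: "integrable q ?b" using igq iq by auto
    have b0: "?b z \<ge> 0" for z
      by (rule add_nonneg_nonneg[OF _ mult_nonneg_nonneg[OF coef]]) (use g t in auto)
    have "ennreal (V powr (1 / n) * (\<integral>z. ?b z \<partial>q)) = ennreal (\<integral>z. V powr (1 / n) * ?b z \<partial>q)"
      using ib by simp
    also have "\<dots> = (\<integral>\<^sup>+z. ennreal (V powr (1 / n) * ?b z) \<partial>q)"
      using ib b0 by (subst nn_integral_eq_integral) auto
    also have "\<dots> \<le> (\<integral>\<^sup>+z. (sigma_coeff K n (1 - t) (dist (fst z) (snd z)) * ennreal ((h (fst z) / V) powr (- 1 / n)) +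
              sigma_coeff K n t (dist (fst z) (snd z)) * ennreal ((1 / V) powr (- 1 / n))) \<partial>q)"
    proof (rule nn_integral_mono)
      fix z :: "'a \<times> 'a"
      define x where "x = K * (dist (fst z) (snd z))\<^sup>2 / n"
      define y where "y = V powr (1 / n)"
      have x0: "x \<ge> 0" using K_pos n by (simp add: x_def)
      have y0: "y > 0" using V by (simp add: y_def)
      have hp: "(h (fst z) / V) powr (- 1 / n) = y * g (fst z)"
        using V h[of "fst z"] by (simp add: powr_divide g_def y_def powr_minus_divide)
      have vp: "(1 / V) powr (- 1 / n) = y"
        using V by (simp add: powr_divide y_def powr_minus_divide)
      define s1 where "s1 = (1 - t) * (1 + (1 - (1 - t)\<^sup>2) * x / 6)"
      define s2 where "s2 = t * (1 + (1 - t\<^sup>2) * x / 6)"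
      have t3: "(1 - t)\<^sup>2 \<le> 1" using t by (simp add: power_le_one)
      have s10: "s1 \<ge> 0" unfolding s1_def using t t3 x0 by (intro mult_nonneg_nonneg add_nonneg_nonneg) auto
      have s20: "s2 \<ge> 0" unfolding s2_def using t t2 x0 by (intro mult_nonneg_nonneg add_nonneg_nonneg) auto
      have "?b z = (1 - t) * g (fst z) + t + (1 - t) * (1 - (1 - t)\<^sup>2) * x / 6 * (1 / (1 + d)) + t * (1 - t\<^sup>2) * x / 6"
      proof -
        have "j / 6 * t * ((1 - t) * (2 - t) * i + (1 - t\<^sup>2)) * y
            = (1 - t) * (1 - (1 - t)\<^sup>2) * (j * y) / 6 * i + t * (1 - t\<^sup>2) * (j * y) / 6" for j y i
          by (simp add: power2_eq_square field_simps)
        from this[of "K / n" "1 / (1 + d)" "(dist (fst z) (snd z))\<^sup>2"]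
        show ?thesis by (simp add: x_def mult.commute[of n])
      qed
      also have "\<dots> \<le> (1 - t) * g (fst z) + t + (1 - t) * (1 - (1 - t)\<^sup>2) * x / 6 * g (fst z) + t * (1 - t\<^sup>2) * x / 6"
        using t t3 x0 g by (intro add_mono mult_left_mono order.refl) auto
      also have "\<dots> = s1 * g (fst z) + s2" by (simp add: s1_def s2_def field_simps)
      finally have "?b z \<le> s1 * g (fst z) + s2" .
      then have "y * ?b z \<le> y * (s1 * g (fst z) + s2)" using y0 by (intro mult_left_mono) auto
      also have "\<dots> = s1 * (y * g (fst z)) + s2 * y" by (simp add: algebra_simps)
      finally have "y * ?b z \<le> s1 * (y * g (fst z)) + s2 * y" .
      then have "ennreal (y * ?b z) \<le> ennreal (s1 * (y * g (fst z)) + s2 * y)" by (rule ennreal_leI)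
      also have "\<dots> = ennreal s1 * ennreal (y * g (fst z)) + ennreal s2 * ennreal y"
        using s10 s20 y0 g by (simp add: ennreal_mult ennreal_plus)
      also have "\<dots> \<le> sigma_coeff K n (1 - t) (dist (fst z) (snd z)) * ennreal (y * g (fst z)) +
          sigma_coeff K n t (dist (fst z) (snd z)) * ennreal y"
        unfolding s1_def s2_def x_def
        using K_pos n t by (intro add_mono mult_right_mono sigma_coeff_ge) auto
      finally show "ennreal (V powr (1 / n) * ?b z)
        \<le> sigma_coeff K n (1 - t) (dist (fst z) (snd z)) * ennreal ((h (fst z) / V) powr (- 1 / n)) +
          sigma_coeff K n t (dist (fst z) (snd z)) * ennreal ((1 / V) powr (- 1 / n))"
        unfolding hp vp by (simp add: y_def)
    qed
    also have "\<dots> \<le> (\<integral>\<^sup>+x. ennreal (dens m (\<Gamma> t) x powr a) \<partial>m)"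
      unfolding a_def using t n by (intro ineq[rule_format]) auto
    finally show ?thesis .
  qed
  have upper: "(\<integral>\<^sup>+x. ennreal (dens m (\<Gamma> t) x powr a) \<partial>m) \<le> ennreal (V powr (1 / n) * ((1 - a) * P + a * Q))"
  proof -
    let ?\<rho> = "dens m (\<Gamma> t)"
    have rm[measurable]: "?\<rho> \<in> borel_measurable m" unfolding dens_def by measurable
    have rnn: "?\<rho> x \<ge> 0" for x by (simp add: dens_def)
    note dd = Pinf_density_dens[OF Pt]
    have sp: "space (\<Gamma> t) = UNIV" "prob_space (\<Gamma> t)" "sets (\<Gamma> t) = sets borel"
      using Pt sets_eq_imp_space_eq[of "\<Gamma> t" borel] by (auto simp: Pinf_def P2_def)
    interpret \<Gamma>t: prob_space "\<Gamma> t" by fact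
    have ig: "integrable (\<Gamma> t) g"
      by (rule \<Gamma>t.integrable_const_bound[of _ 2]) (use g gbd sp in \<open>auto cong: measurable_cong_sets\<close>)
    have igr: "integrable m (\<lambda>x. ?\<rho> x * g x)"
    proof -
      have "integrable (density m (\<lambda>x. ennreal (?\<rho> x))) g" using ig unfolding dd .
      then show ?thesis by (subst (asm) integrable_density) (auto simp: rnn)
    qed
    have Qr: "(\<integral>x. ?\<rho> x * g x \<partial>m) = Q"
    proof -
      have "(\<integral>x. g x \<partial>density m (\<lambda>x. ennreal (?\<rho> x))) = (\<integral>x. ?\<rho> x *\<^sub>R g x \<partial>m)"
        by (rule integral_density) (auto simp: rnn)
      then show ?thesis unfolding dd Q_def by simp
    qed
    have iha: "integrable m (\<lambda>x. h x powr a)"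
    proof (rule integrable_const_bound[of _ 3])
      have "h x powr a \<le> 3" for x
        using powr_le_one_plus[of "h x" a] h[of x] a d by linarith
      then show "AE x in m. norm (h x powr a) \<le> 3" by simp
    qed measurable
    let ?u = "\<lambda>x. V powr (1 / n) * ((1 - a) * (h x powr a / V) + a * (?\<rho> x * g x))"
    have iu: "integrable m ?u" using iha igr by auto
    \<comment> \<open>Tangent of the concave power at the initial density h / V; the remaining term
      is linear in the density of \<open>\<Gamma> t\<close> and integrates to Q.\<close>
    have pt: "?\<rho> x powr a \<le> ?u x" for x
    proof -
      have a1: "1 - a = 1 / n" "a - 1 = - 1 / n" by (simp_all add: a_def)
      note sc = powr_divide_scale[OF V(1) h(4)[of x], of a, unfolded a1]
      note tg = powr_le_tangent[OF rnn[of x] divide_pos_pos[OF h(4)[of x] V(1)] a, unfolded a1 sc]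
      show ?thesis
        using tg unfolding g_def a1 by (simp add: algebra_simps)
    qed
    have "(\<integral>\<^sup>+x. ennreal (?\<rho> x powr a) \<partial>m) \<le> (\<integral>\<^sup>+x. ennreal (?u x) \<partial>m)"
      by (intro nn_integral_mono ennreal_leI pt)
    also have "\<dots> = ennreal (\<integral>x. ?u x \<partial>m)"
      by (rule nn_integral_eq_integral[OF iu]) (rule AE_I2, rule order.trans[OF powr_ge_zero pt])
    also have "(\<integral>x. ?u x \<partial>m) = V powr (1 / n) * ((1 - a) * P + a * Q)"
      using iha igr by (simp add: Qr PV)
    finally show ?thesis .
  qed
  have Q0: "Q \<ge> 0" "P \<ge> 0" using g by (auto simp: Q_def P)
  have "ennreal (V powr (1 / n) * (\<integral>z. ?b z \<partial>q)) \<le> ennreal (V powr (1 / n) * ((1 - a) * P + a * Q))"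
    using lower upper by (rule order.trans)
  then have "V powr (1 / n) * (\<integral>z. ?b z \<partial>q) \<le> V powr (1 / n) * ((1 - a) * P + a * Q)"
    using Q0 a V by (subst (asm) ennreal_le_iff) auto
  then have I1: "(\<integral>z. ?b z \<partial>q) \<le> (1 - a) * P + a * Q" using V by simp
  have I2: "(\<integral>z. ?b z \<partial>q) = (1 - t) * P + t +
      K / (6 * n) * t * ((1 - t) * (2 - t) / (1 + d) + (1 - t\<^sup>2)) * W\<^sup>2"
  proof -
    have "(\<integral>z. g (fst z) \<partial>q) = P" unfolding P by (rule integral_coupling_fst[OF qc gm])
    moreover have "(\<integral>z. (dist (fst z) (snd z))\<^sup>2 \<partial>q) = W\<^sup>2" using cost by (simp add: transport_cost_def)
    ultimately show ?thesis using igq iq by (simp add: q.prob_space)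
  qed
  define X where "X = e / (n * (1 - d)\<^sup>2) * (t * l / 2 * G + t * W\<^sup>2 / (2 * l) + L * t\<^sup>2 * W\<^sup>2 / r)"
  have X0: "X \<ge> 0"
    unfolding X_def G_def using e n d t l r lipschitz_on_nonneg[OF lip]
    by (intro mult_nonneg_nonneg add_nonneg_nonneg divide_nonneg_nonneg) auto
  have "Q - P \<le> X"
  proof -
    let ?G = "\<lambda>x. (enn2real (slope_at_scale f r x))\<^sup>2"
    let ?D = "\<lambda>z. (dist (fst z) (snd z))\<^sup>2"
    have sm[measurable]: "slope_at_scale f r \<in> borel_measurable borel"
      by (rule slope_at_scale_measurable[OF fc])
    have Gm: "?G \<in> borel_measurable borel" by measurable
    have iG: "integrable q1 (\<lambda>z. ?G (fst z))"
    proof (rule q1.integrable_const_bound[of _ "L\<^sup>2"])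
      have "enn2real (slope_at_scale f r x) \<le> L" for x
        using slope_at_scale_le_lipschitz[OF lip, of r x] lipschitz_on_nonneg[OF lip] by (intro enn2real_leI)
      then show "AE z in q1. norm (?G (fst z)) \<le> L\<^sup>2" by (auto intro!: power_mono)
    qed measurable
    have VG: "(\<integral>z. ?G (fst z) \<partial>q1) = G"
      unfolding G_def by (rule integral_coupling_fst[OF q1(1) Gm])
    have VD: "(\<integral>z. ?D z \<partial>q1) = t\<^sup>2 * W\<^sup>2"
      using q1(2) by (simp add: transport_cost_def power_mult_distrib)
    have "Q - P = (\<integral>z. g (snd z) - g (fst z) \<partial>q1)"
      using igq1 integral_coupling_fst[OF q1(1) gm] integral_coupling_snd[OF q1(1) gm] by (simp add: P Q_def)
    \<comment> \<open>The Young weight is t l, proportional to time: as the squared distance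
      integrates to t^2 W^2, both Young terms are of order t, and the contribution of distances
      beyond r is of order t^2.\<close>
    also have "\<dots> \<le> (\<integral>z. e / (n * (1 - d)\<^sup>2) * (t * l / 2 * ?G (fst z) + ?D z / (2 * (t * l)) + L * ?D z / r) \<partial>q1)"
    proof (rule integral_mono)
      fix z :: "'a \<times> 'a"
      have "g (snd z) - g (fst z) \<le> 1 / n / (1 - d)\<^sup>2 * max (h (fst z) - h (snd z)) 0"
        unfolding g_def using powr_minus_diff_le[of d "h (snd z)" "h (fst z)" "1 / n"] h d n by simp
      also have "max (h (fst z) - h (snd z)) 0 = e * max (f (fst z) - f (snd z)) 0"
        using e by (auto simp: h_def max_def algebra_simps)
      also have "1 / n / (1 - d)\<^sup>2 * (e * max (f (fst z) - f (snd z)) 0)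
          = e / (n * (1 - d)\<^sup>2) * max (f (fst z) - f (snd z)) 0" by simp
      also have "\<dots> \<le> e / (n * (1 - d)\<^sup>2) * (t * l / 2 * ?G (fst z) + ?D z / (2 * (t * l)) + L * ?D z / r)"
        using e n t l by (intro mult_left_mono decrease_le_slope[OF lip r]) auto
      finally show "g (snd z) - g (fst z)
        \<le> e / (n * (1 - d)\<^sup>2) * (t * l / 2 * ?G (fst z) + ?D z / (2 * (t * l)) + L * ?D z / r)" .
    qed (use igq1 iG iq1 in auto)
    also have "\<dots> = e / (n * (1 - d)\<^sup>2) * (t * l / 2 * G + t\<^sup>2 * W\<^sup>2 / (2 * (t * l)) + L * (t\<^sup>2 * W\<^sup>2) / r)"
      using iG iq1 by (simp add: VG VD)
    also have "\<dots> = X" unfolding X_def using t l by (simp add: power2_eq_square)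
    finally show ?thesis .
  qed
  then have aX: "a * (Q - P) \<le> a * X" using a by (intro mult_left_mono) auto
  have "a * X \<le> 1 * X" using a X0 by (intro mult_right_mono) auto
  with aX have "a * Q \<le> a * P + X" by (simp add: algebra_simps)
  with I1 I2 have I3: "(1 - t) * P + t +
      K / (6 * n) * t * ((1 - t) * (2 - t) / (1 + d) + (1 - t\<^sup>2)) * W\<^sup>2 \<le> P + X"
    by (simp only:) (simp add: left_diff_distrib)
  \<comment> \<open>Exhibits the common factor t, whose cancellation leaves the difference quotient
    in time.\<close>
  have "t * (1 - P + K / (6 * n) * W\<^sup>2 * y) = (1 - t) * P + t + K / (6 * n) * t * y * W\<^sup>2 - P" for y
    by (simp add: algebra_simps)
  with I3 have "t * (1 - P + K / (6 * n) * W\<^sup>2 * ((1 - t) * (2 - t) / (1 + d) + (1 - t\<^sup>2))) \<le> X"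
    by simp
  also have "X = t * (e / (n * (1 - d)\<^sup>2) * (l / 2 * G + W\<^sup>2 / (2 * l) + L * t * W\<^sup>2 / r))"
    unfolding X_def by (simp add: power2_eq_square algebra_simps)
  finally show ?thesis unfolding d_def using t(1) by (rule mult_left_le_imp_le)
qed

text \<open>As t tends to 0 the entropy variation keeps a curvature term of at least K W^2 / (2 n (1
  + d)) on the left, and l is tuned so that the Young term on the right is no larger. What remains
  is of order e^2 on both sides: the variance from the expansion of P, and the slope term, whose
  weight e l is proportional to e^2 / K.\<close>

lemma second_order_inequality:
  fixes f :: "'a \<Rightarrow> real"
  assumes lip: "L-lipschitz_on UNIV f" and F: "\<And>x. \<bar>f x\<bar> \<le> F"
    and int0: "(\<integral>x. f x \<partial>m) = 0" and mpos: "emeasure m UNIV > 0"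
    and e: "e > 0" "e * F \<le> 1 / 2" and n: "n \<ge> N" "n > 1" and r: "r > 0"
  shows "(1 - 1 / n) * (K * (\<integral>x. (f x)\<^sup>2 \<partial>m))
    \<le> ((1 + e * F) / (1 - e * F)) ^ 4 * (\<integral>x. (enn2real (slope_at_scale f r x))\<^sup>2 \<partial>m)"
proof -
  interpret finite_measure m by (rule finite_measure_m)
  define d where "d = e * F"
  have d: "0 \<le> d" "d \<le> 1 / 2" using e F[of undefined] by (auto simp: d_def)
  define V where "V = measure m UNIV"
  have V: "V > 0" using mpos by (auto simp: V_def emeasure_eq_measure)
  define a where "a = 1 - 1 / n"
  have a: "0 < a" "a < 1" using n by (auto simp: a_def)
  define h where "h x = 1 + e * f x" for x
  have ef: "\<bar>e * f x\<bar> \<le> d" for x using F[of x] e by (simp add: abs_mult d_def)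
  have h: "h x \<le> 1 + d" "h x > 0" for x using ef[of x] d by (auto simp: h_def)
  have fc: "continuous_on UNIV f" using lip by (rule lipschitz_on_continuous_on)
  have fm[measurable]: "f \<in> borel_measurable borel" using fc by (rule borel_measurable_continuous_onI)
  have hm[measurable]: "h \<in> borel_measurable borel" unfolding h_def by measurable
  have sm[measurable]: "slope_at_scale f r \<in> borel_measurable borel"
    by (rule slope_at_scale_measurable[OF fc])
  define g where "g x = (enn2real (slope_at_scale f r x))\<^sup>2" for x
  have gm[measurable]: "g \<in> borel_measurable borel" unfolding g_def by measurable
  have g: "0 \<le> g x" "g x \<le> L\<^sup>2" for x
  proof -
    have "enn2real (slope_at_scale f r x) \<le> L"
      using slope_at_scale_le_lipschitz[OF lip, of r x] lipschitz_on_nonneg[OF lip] by (intro enn2real_leI)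
    then show "g x \<le> L\<^sup>2" by (auto simp: g_def intro!: power_mono)
  qed (simp add: g_def)
  define I where "I = (\<integral>x. (f x)\<^sup>2 \<partial>m)"
  define J where "J = (\<integral>x. g x \<partial>m)"
  define \<nu> where "\<nu> = density m (\<lambda>x. ennreal (h x / V))"
  define W where "W = wasserstein \<nu> (density m (\<lambda>x. ennreal (1 / V)))"
  define P where "P = (\<integral>x. h x powr a \<partial>m) / V"
  define G where "G = (\<integral>x. g x \<partial>\<nu>)"
  have fi: "integrable m f"
    by (rule integrable_const_bound[of _ F]) (use F in auto)
  have f2i: "integrable m (\<lambda>x. (f x)\<^sup>2)"
  proof (rule integrable_const_bound[of _ "F\<^sup>2"])
    show "AE x in m. norm ((f x)\<^sup>2) \<le> F\<^sup>2"
      using F by (auto intro!: AE_I2 power2_le_iff_abs_le[THEN iffD2] order.trans[OF abs_ge_zero F])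
  qed measurable
  have gi: "integrable m g"
    by (rule integrable_const_bound[of _ "L\<^sup>2"]) (use g in auto)
  have G: "G \<le> (1 + d) / V * J"
  proof -
    have "G = (\<integral>x. (h x / V) *\<^sub>R g x \<partial>m)"
      unfolding G_def \<nu>_def using h V by (intro integral_density) (auto simp: less_imp_le)
    also have "\<dots> \<le> (\<integral>x. (1 + d) / V * g x \<partial>m)"
    proof (rule integral_mono)
      show "integrable m (\<lambda>x. (h x / V) *\<^sub>R g x)"
      proof (rule integrable_const_bound[of _ "(1 + d) / V * L\<^sup>2"])
        have "norm ((h x / V) *\<^sub>R g x) \<le> (1 + d) / V * L\<^sup>2" for x
          using h[of x] g[of x] V d
          by (simp add: abs_mult, intro mult_mono divide_right_mono) auto
        then show "AE x in m. norm ((h x / V) *\<^sub>R g x) \<le> (1 + d) / V * L\<^sup>2" by simp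
      qed measurable
      show "(h x / V) *\<^sub>R g x \<le> (1 + d) / V * g x" for x
        using h[of x] g[of x] V by (simp, intro divide_right_mono mult_right_mono) auto
    qed (use gi in simp)
    also have "\<dots> = (1 + d) / V * J" by (simp add: J_def)
    finally show ?thesis .
  qed
  \<comment> \<open>The first-order term in e disappears since f has mean zero.\<close>
  have P: "P \<le> 1 - a * (1 / n) / (2 * (1 + d)\<^sup>2) * (e\<^sup>2 * I / V)"
  proof -
    let ?q = "\<lambda>x. 1 + a * (e * f x) - a * (1 - a) / (2 * (1 + d)\<^sup>2) * (e\<^sup>2 * (f x)\<^sup>2)"
    have qi: "integrable m ?q" using fi f2i by simp
    have le: "h x powr a \<le> ?q x" for x
      using powr_le_quadratic[of "h x" d a] h[of x] d a by (simp add: h_def power_mult_distrib)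
    have "integrable m (\<lambda>x. h x powr a)"
    proof (rule Bochner_Integration.integrable_bound[OF qi])
      have "\<bar>h x powr a\<bar> \<le> \<bar>?q x\<bar>" for x using order.trans[OF le abs_ge_self] by simp
      then show "AE x in m. norm (h x powr a) \<le> norm (?q x)"
        by (simp only: real_norm_def) simp
    qed measurable
    then have "(\<integral>x. h x powr a \<partial>m) \<le> (\<integral>x. ?q x \<partial>m)"
      using qi le by (intro integral_mono) auto
    also have "\<dots> = V - a * (1 - a) / (2 * (1 + d)\<^sup>2) * (e\<^sup>2 * I)"
      using fi f2i by (simp add: int0 I_def V_def)
    finally have "P \<le> (V - a * (1 - a) / (2 * (1 + d)\<^sup>2) * (e\<^sup>2 * I)) / V"
      unfolding P_def using V by (intro divide_right_mono) auto
    also have "\<dots> = 1 - a * (1 - a) / (2 * (1 + d)\<^sup>2) * (e\<^sup>2 * I / V)"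
      using V by (simp add: diff_divide_distrib)
    finally show ?thesis by (simp add: a_def)
  qed
  \<comment> \<open>The solution of e / (2 l n (1 - d)^2) = K / (2 n (1 + d)), and 3 / (1 + d) \<le>
    2 / (1 + d) + 1.\<close>
  define l where "l = e * (1 + d) / (K * (1 - d)\<^sup>2)"
  have l: "l > 0" using e d K_pos by (simp add: l_def)
  have var: "1 - P + K / (6 * n) * W\<^sup>2 * ((1 - t) * (2 - t) / (1 + d) + (1 - t\<^sup>2))
      \<le> e / (n * (1 - d)\<^sup>2) * (l / 2 * G + W\<^sup>2 / (2 * l) + L * t * W\<^sup>2 / r)"
    if "0 < t" "t \<le> 1 / 2" for t
    using entropy_variation[OF lip F int0 mpos e that n l r]
    unfolding P_def W_def G_def \<nu>_def V_def d_def h_def g_def a_def .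
  \<comment> \<open>The limit t to 0 with r fixed, in which the term L t W^2 / r disappears. P, G
    and W do not depend on t.\<close>
  have "1 - P + K / (6 * n) * W\<^sup>2 * ((1 - 0) * (2 - 0) / (1 + d) + (1 - 0\<^sup>2))
      \<le> e / (n * (1 - d)\<^sup>2) * (l / 2 * G + W\<^sup>2 / (2 * l) + L * 0 * W\<^sup>2 / r)"
  proof (rule tendsto_le)
    show "at_right (0::real) \<noteq> bot" by simp
    show "((\<lambda>t. 1 - P + K / (6 * n) * W\<^sup>2 * ((1 - t) * (2 - t) / (1 + d) + (1 - t\<^sup>2))) \<longlongrightarrow>
        1 - P + K / (6 * n) * W\<^sup>2 * ((1 - 0) * (2 - 0) / (1 + d) + (1 - 0\<^sup>2))) (at_right 0)"
      using d by (intro tendsto_intros) auto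
    show "((\<lambda>t. e / (n * (1 - d)\<^sup>2) * (l / 2 * G + W\<^sup>2 / (2 * l) + L * t * W\<^sup>2 / r)) \<longlongrightarrow>
        e / (n * (1 - d)\<^sup>2) * (l / 2 * G + W\<^sup>2 / (2 * l) + L * 0 * W\<^sup>2 / r)) (at_right 0)"
      using r by (intro tendsto_intros) auto
    show "\<forall>\<^sub>F t in at_right 0. 1 - P + K / (6 * n) * W\<^sup>2 * ((1 - t) * (2 - t) / (1 + d) + (1 - t\<^sup>2))
      \<le> e / (n * (1 - d)\<^sup>2) * (l / 2 * G + W\<^sup>2 / (2 * l) + L * t * W\<^sup>2 / r)"
      by (rule eventually_at_rightI[of 0 "1 / 2"]) (use var in auto)
  qed
  then have main: "1 - P + K / (6 * n) * W\<^sup>2 * (2 / (1 + d) + 1)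
      \<le> e / (n * (1 - d)\<^sup>2) * (l / 2 * G + W\<^sup>2 / (2 * l))" by simp
  have "e / (n * (1 - d)\<^sup>2) * (W\<^sup>2 / (2 * l)) = K / (6 * n) * W\<^sup>2 * (3 / (1 + d))"
  proof -
    have *: "e / (n * c) * (w / (2 * (e * p / (K * c)))) = K / (6 * n) * w * (3 / p)"
      if "c > 0" "p > 0" for c p w
      using that e K_pos n by (simp add: field_simps)
    show ?thesis unfolding l_def by (rule *) (use d in auto)
  qed
  also have "\<dots> \<le> K / (6 * n) * W\<^sup>2 * (2 / (1 + d) + 1)"
    using d K_pos n by (intro mult_left_mono) (auto simp: field_simps)
  finally have "1 - P \<le> e / (n * (1 - d)\<^sup>2) * (l / 2 * G)"
    using main by (simp add: distrib_left)
  also have "\<dots> \<le> e / (n * (1 - d)\<^sup>2) * (l / 2 * ((1 + d) / V * J))"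
    using G e d n l by (intro mult_left_mono) auto
  finally have "a * (1 / n) / (2 * (1 + d)\<^sup>2) * (e\<^sup>2 * I / V)
      \<le> e / (n * (1 - d)\<^sup>2) * (l / 2 * ((1 + d) / V * J))" using P by linarith
  \<comment> \<open>The multiplier clears the left side. The fourth power collects (1 + d)^2 from
    the quadratic bound, 1 + d from l and from the density of \<open>\<nu>\<close>, and (1 - d)^(-2)
    from l and from the prefactor.\<close>
  then have "(2 * n * V * K * (1 + d)\<^sup>2 / e\<^sup>2) * (a * (1 / n) / (2 * (1 + d)\<^sup>2) * (e\<^sup>2 * I / V))
      \<le> (2 * n * V * K * (1 + d)\<^sup>2 / e\<^sup>2) * (e / (n * (1 - d)\<^sup>2) * (l / 2 * ((1 + d) / V * J)))"
    using n V K_pos by (intro mult_left_mono) auto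
  moreover have "(2 * n * V * K * (1 + d)\<^sup>2 / e\<^sup>2) * (a * (1 / n) / (2 * (1 + d)\<^sup>2) * (e\<^sup>2 * I / V)) = a * (K * I)"
    using n V K_pos e d by (simp add: divide_simps)
  moreover have "(2 * n * V * K * (1 + d)\<^sup>2 / e\<^sup>2) * (e / (n * (1 - d)\<^sup>2) * (l / 2 * ((1 + d) / V * J)))
      = ((1 + d) / (1 - d)) ^ 4 * J"
  proof -
    have *: "x ^ 4 = x\<^sup>2 * x\<^sup>2" for x :: real by (simp add: power2_eq_square numeral_eq_Suc)
    show ?thesis
      unfolding l_def power_divide * using n V K_pos e d by (simp add: divide_simps power2_eq_square)
  qed
  ultimately show ?thesis by (simp add: a_def I_def J_def d_def g_def)
qed

section \<open>Limits in the dimension parameter, the perturbation and the scale\<close>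

text \<open>The condition holds for every n \<ge> N, so n can go to infinity for a fixed
  perturbation d = e F, and then d to 0. Expressing e as d / F is what asks for F > 0.\<close>

lemma poincare_at_scale:
  fixes f :: "'a \<Rightarrow> real"
  assumes lip: "L-lipschitz_on UNIV f" and F: "\<And>x. \<bar>f x\<bar> \<le> F" "F > 0"
    and int0: "(\<integral>x. f x \<partial>m) = 0" and mpos: "emeasure m UNIV > 0" and r: "r > 0"
  shows "K * (\<integral>x. (f x)\<^sup>2 \<partial>m) \<le> (\<integral>x. (enn2real (slope_at_scale f r x))\<^sup>2 \<partial>m)"
proof -
  define I where "I = K * (\<integral>x. (f x)\<^sup>2 \<partial>m)"
  define J where "J = (\<integral>x. (enn2real (slope_at_scale f r x))\<^sup>2 \<partial>m)"
  have 1: "(1 - 1 / n) * I \<le> ((1 + d) / (1 - d)) ^ 4 * J"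
    if d: "0 < d" "d \<le> 1 / 2" and n: "n \<ge> N" "n > 1" for d n
    using second_order_inequality[OF lip F(1) int0 mpos, of "d / F" n r] d n r F(2)
    by (simp add: I_def J_def)
  have 2: "I \<le> ((1 + d) / (1 - d)) ^ 4 * J" if d: "0 < d" "d \<le> 1 / 2" for d
  proof (rule tendsto_upperbound)
    have "((\<lambda>n::real. 1 / n) \<longlongrightarrow> 0) at_top"
      by (rule real_tendsto_divide_at_top[OF tendsto_const filterlim_ident])
    then have "((\<lambda>n::real. (1 - 1 / n) * I) \<longlongrightarrow> (1 - 0) * I) at_top" by (intro tendsto_intros)
    then show "((\<lambda>n::real. (1 - 1 / n) * I) \<longlongrightarrow> I) at_top" by simp
    show "\<forall>\<^sub>F n in at_top. (1 - 1 / n) * I \<le> ((1 + d) / (1 - d)) ^ 4 * J"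
      using eventually_ge_at_top[of N] eventually_gt_at_top[of 1] by eventually_elim (rule 1[OF d])
  qed simp
  have "I \<le> J"
  proof (rule tendsto_lowerbound)
    have "((\<lambda>d::real. ((1 + d) / (1 - d)) ^ 4 * J) \<longlongrightarrow> ((1 + 0) / (1 - 0)) ^ 4 * J) (at_right 0)"
      by (intro tendsto_intros) auto
    then show "((\<lambda>d::real. ((1 + d) / (1 - d)) ^ 4 * J) \<longlongrightarrow> J) (at_right 0)" by simp
    show "\<forall>\<^sub>F d in at_right 0. I \<le> ((1 + d) / (1 - d)) ^ 4 * J"
      by (rule eventually_at_rightI[of 0 "1 / 2"]) (use 2 in auto)
  qed simp
  then show ?thesis by (simp add: I_def J_def)
qed

text \<open>The slopes at scale 1 / (i + 1) decrease to the descending slope and are bounded by L,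
  which is square integrable because m is finite.\<close>

lemma poincare_bounded:
  fixes f :: "'a \<Rightarrow> real"
  assumes lip: "L-lipschitz_on UNIV f" and F: "\<And>x. \<bar>f x\<bar> \<le> F" "F > 0"
    and int0: "(\<integral>x. f x \<partial>m) = 0" and mpos: "emeasure m UNIV > 0"
  shows "ennreal K * (\<integral>\<^sup>+x. ennreal ((f x)\<^sup>2) \<partial>m) \<le> (\<integral>\<^sup>+x. (desc_slope f x)\<^sup>2 \<partial>m)"
proof -
  interpret finite_measure m by (rule finite_measure_m)
  have fc: "continuous_on UNIV f" using lip by (rule lipschitz_on_continuous_on)
  have fm[measurable]: "f \<in> borel_measurable borel" using fc by (rule borel_measurable_continuous_onI)
  have sm[measurable]: "slope_at_scale f r \<in> borel_measurable borel" for r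
    by (rule slope_at_scale_measurable[OF fc])
  have L0: "0 \<le> L" using lip by (rule lipschitz_on_nonneg)
  have le: "slope_at_scale f r x \<le> ennreal L" for r x by (rule slope_at_scale_le_lipschitz[OF lip])
  have f2i: "integrable m (\<lambda>x. (f x)\<^sup>2)"
  proof (rule integrable_const_bound[of _ "F\<^sup>2"])
    show "AE x in m. norm ((f x)\<^sup>2) \<le> F\<^sup>2"
      using F by (auto intro!: AE_I2 power2_le_iff_abs_le[THEN iffD2])
  qed measurable
  have step: "ennreal K * (\<integral>\<^sup>+x. ennreal ((f x)\<^sup>2) \<partial>m) \<le> (\<integral>\<^sup>+x. (slope_at_scale f r x)\<^sup>2 \<partial>m)"
    if r: "r > 0" for r
  proof -
    let ?g = "\<lambda>x. enn2real (slope_at_scale f r x)"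
    have eq: "slope_at_scale f r x = ennreal (?g x)" for x
      using le[of r x] by (metis ennreal_enn2real ennreal_less_top le_less_trans)
    have gi: "integrable m (\<lambda>x. (?g x)\<^sup>2)"
    proof (rule integrable_const_bound[of _ "L\<^sup>2"])
      have "?g x \<le> L" for x using le[of r x] L0 by (intro enn2real_leI)
      then show "AE x in m. norm ((?g x)\<^sup>2) \<le> L\<^sup>2" by (auto intro!: power_mono)
    qed measurable
    have "ennreal K * (\<integral>\<^sup>+x. ennreal ((f x)\<^sup>2) \<partial>m) = ennreal (K * (\<integral>x. (f x)\<^sup>2 \<partial>m))"
      using f2i K_pos by (subst nn_integral_eq_integral) (auto simp: ennreal_mult)
    also have "\<dots> \<le> ennreal (\<integral>x. (?g x)\<^sup>2 \<partial>m)"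
      by (intro ennreal_leI poincare_at_scale[OF lip F int0 mpos r])
    also have "\<dots> = (\<integral>\<^sup>+x. ennreal ((?g x)\<^sup>2) \<partial>m)"
      using gi by (subst nn_integral_eq_integral) auto
    also have "\<dots> = (\<integral>\<^sup>+x. (slope_at_scale f r x)\<^sup>2 \<partial>m)"
      by (intro nn_integral_cong) (subst (2) eq, simp add: ennreal_power)
    finally show ?thesis .
  qed
  have "(\<lambda>i. \<integral>\<^sup>+x. (slope_at_scale f (1 / real (Suc i)) x)\<^sup>2 \<partial>m) \<longlonglongrightarrow> (\<integral>\<^sup>+x. (desc_slope f x)\<^sup>2 \<partial>m)"
  proof (rule nn_integral_dominated_convergence[where w = "\<lambda>x. ennreal (L\<^sup>2)"])
    have lim: "(\<lambda>i. (slope_at_scale f (1 / real (Suc i)) x)\<^sup>2) \<longlonglongrightarrow> (desc_slope f x)\<^sup>2" for x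
      unfolding power2_eq_square
      by (rule tendsto_mult_ennreal[OF slope_at_scale_LIMSEQ slope_at_scale_LIMSEQ]) auto
    show "AE x in m. (\<lambda>i. (slope_at_scale f (1 / real (Suc i)) x)\<^sup>2) \<longlonglongrightarrow> (desc_slope f x)\<^sup>2"
      using lim by simp
    show "(\<lambda>x. (desc_slope f x)\<^sup>2) \<in> borel_measurable m"
      by (rule borel_measurable_LIMSEQ_order[OF lim]) measurable
    show "AE x in m. (slope_at_scale f (1 / real (Suc i)) x)\<^sup>2 \<le> ennreal (L\<^sup>2)" for i
      using le L0 by (intro AE_I2) (auto simp: ennreal_power[symmetric] intro!: power_mono)
    show "(\<integral>\<^sup>+x. ennreal (L\<^sup>2) \<partial>m) < \<infinity>"
      by (simp add: ennreal_mult_less_top emeasure_eq_measure)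
  qed measurable
  then show ?thesis
    by (rule LIMSEQ_le_const) (auto intro!: exI[of _ 0] step)
qed

end

section \<open>Truncation of an arbitrary Lipschitz function\<close>

theorem theorem6p5:
  fixes m :: "'a::polish_space measure" and K N :: real and f :: "'a \<Rightarrow> real"
  assumes "metric_measure_space m"
    and "K > 0" and "N \<ge> 1"
    and "CD_star K N m"
    and "\<exists>L. L-lipschitz_on UNIV f"
    and "has_bochner_integral m f 0"
  shows "(\<integral>\<^sup>+x. ennreal ((f x)\<^sup>2) \<partial>m) \<le> ennreal (1 / K) * (\<integral>\<^sup>+x. (desc_slope f x)\<^sup>2 \<partial>m)"
proof -
  interpret cd_space m K N by unfold_locales (use assms in auto)
  obtain L where L: "L-lipschitz_on UNIV f" using assms by blast
  show ?thesis
  proof (cases "emeasure m UNIV = 0")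
    \<comment> \<open>The zero measure has empty support, hence no base point for the truncation
      level.\<close>
    case True
    then have "AE x in m. ennreal ((f x)\<^sup>2) = 0"
      by (intro AE_I'[of UNIV]) (auto simp: null_sets_def sets_m)
    then show ?thesis by (subst nn_integral_cong_AE[where v = "\<lambda>_. 0"]) auto
  next
    case False
    obtain x0 where x0: "x0 \<in> measure_support m" using support_nonempty[OF False] by blast
    \<comment> \<open>Bounds f on a ball carrying almost all of m, although f may be unbounded off
      the support. The last 1 makes F positive.\<close>
    define F where "F = \<bar>f x0\<bar> + L * (pi * sqrt (N / K) + 1) + 1"
    have L0: "0 \<le> L" using L by (rule lipschitz_on_nonneg)
    have F0: "F > 0" using L0 K_pos N_ge by (simp add: F_def add_nonneg_pos)
    define g where "g x = max (- F) (min F (f x))" for x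
    have gf: "AE x in m. g x = f x"
      using AE_dist_less[OF x0]
    proof eventually_elim
      case (elim x)
      have "\<bar>f x0 - f x\<bar> \<le> L * dist x0 x" using lipschitz_onD[OF L, of x0 x] by (simp add: dist_real_def)
      also have "\<dots> \<le> L * (pi * sqrt (N / K) + 1)" using elim L0 by (intro mult_left_mono) auto
      finally show ?case by (simp add: g_def F_def)
    qed
    have gL: "L-lipschitz_on UNIV g"
    proof (rule lipschitz_onI)
      fix x y
      have "dist (g x) (g y) \<le> dist (f x) (f y)" by (simp add: g_def dist_real_def)
      also have "\<dots> \<le> L * dist x y" by (rule lipschitz_onD[OF L]) auto
      finally show "dist (g x) (g y) \<le> L * dist x y" .
    qed (rule L0)
    have gb: "\<bar>g x\<bar> \<le> F" for x using F0 by (auto simp: g_def)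
    have gm: "g \<in> borel_measurable m" "f \<in> borel_measurable m"
      using borel_measurable_continuous_onI[OF lipschitz_on_continuous_on[OF gL]]
        borel_measurable_continuous_onI[OF lipschitz_on_continuous_on[OF L]]
      by (simp_all cong: measurable_cong_sets add: sets_m)
    have g0: "(\<integral>x. g x \<partial>m) = 0"
      using integral_cong_AE[OF gm gf] assms(6) by (simp add: has_bochner_integral_integral_eq)
    have "ennreal K * (\<integral>\<^sup>+x. ennreal ((f x)\<^sup>2) \<partial>m) = ennreal K * (\<integral>\<^sup>+x. ennreal ((g x)\<^sup>2) \<partial>m)"
      by (intro arg_cong[where f = "(*) (ennreal K)"] nn_integral_cong_AE) (use gf in eventually_elim, simp)
    also have "\<dots> \<le> (\<integral>\<^sup>+x. (desc_slope g x)\<^sup>2 \<partial>m)"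
      by (rule poincare_bounded[OF gL gb F0 g0]) (use False in \<open>simp add: zero_less_iff_neq_zero\<close>)
    also have "\<dots> \<le> (\<integral>\<^sup>+x. (desc_slope f x)\<^sup>2 \<partial>m)"
      unfolding g_def by (intro nn_integral_mono power_mono desc_slope_clip_le) auto
    finally have le: "ennreal K * (\<integral>\<^sup>+x. ennreal ((f x)\<^sup>2) \<partial>m) \<le> (\<integral>\<^sup>+x. (desc_slope f x)\<^sup>2 \<partial>m)" .
    have "(\<integral>\<^sup>+x. ennreal ((f x)\<^sup>2) \<partial>m) = ennreal (1 / K) * (ennreal K * (\<integral>\<^sup>+x. ennreal ((f x)\<^sup>2) \<partial>m))"
      using K_pos by (simp add: mult.assoc[symmetric] ennreal_mult[symmetric])
    also have "\<dots> \<le> ennreal (1 / K) * (\<integral>\<^sup>+x. (desc_slope f x)\<^sup>2 \<partial>m)"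
      using le by (rule mult_left_mono) simp
    finally show ?thesis .
  qed
qed

end
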